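(* Let $\Omega\subset\mathbb{R}^n$ be a (non-empty) open set with non-empty boundary, and let $\Sigma\subset\partial\Omega$ be an arbitrary non-empty subset of the boundary. Then there exist $\epsilon>0$ and $c>0$ such that for every $C^1$ diffeomorphism $\varphi:\mathbb{R}^n\to\mathbb{R}^n$ with $\|D\varphi-I\|<\epsilon$ (supremum norm over $\mathbb{R}^n$), $$|H(\varphi(\Omega),\varphi(\Sigma))-H(\Omega,\Sigma)|\le c\,H(\Omega,\Sigma)\,\|D\varphi-I\|_{L^\infty(co_\varphi(\Omega))},$$ where $co_\varphi(\Omega)=co(\Omega)\cup\varphi^{-1}(co(\varphi(\Omega)))$.
   Context: For an open set $\Omega\subset\mathbb{R}^n$ and a non-empty $\Sigma\subset\partial\Omega$, put $d_\Sigma(x)=\mathrm{dist}(x,\Sigma)$ (Euclidean distance). The Hardy constant is $$H(\Omega,\Sigma)=\inf_{u\in H^1_0(\Omega),\,u\ne0}\frac{\int_\Omega|\nabla u|^2dx}{\int_\Omega u^2/d_\Sigma^2\,dx}\in[0,\infty),$$ the quotient being $0$ when the denominator is $+\infty$; equivalently it is the largest $C\ge0$ with $\int_\Omega|\nabla u|^2\ge C\int_\Omega u^2/d_\Sigma^2$ for all $u\in H^1_0(\Omega)$. $co(A)$ denotes the convex hull of $A$. $D\varphi$ is the Jacobian matrix, $I$ the identity matrix, and $\|D\varphi-I\|_{L^\infty(A)}$ is the supremum over $x\in A$ of the operator norm of $D\varphi(x)-I$. A $C^1$ diffeomorphism is a $C^1$ bijection with $C^1$ inverse. *)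

theory Defs
  imports "HOL-Analysis.Analysis"
begin

definition partial_deriv :: "'n \<Rightarrow> (real ^ 'n \<Rightarrow> real) \<Rightarrow> real ^ 'n \<Rightarrow> real" where
  "partial_deriv i f x = frechet_derivative f (at x) (axis i 1)"

definition gradient :: "(real ^ 'n \<Rightarrow> real) \<Rightarrow> real ^ 'n \<Rightarrow> real ^ 'n" where
  "gradient f x = (\<chi> i. partial_deriv i f x)"

primrec C_k :: "nat \<Rightarrow> (real ^ 'n \<Rightarrow> real) \<Rightarrow> bool" where
  "C_k 0 f \<longleftrightarrow> continuous_on UNIV f"
| "C_k (Suc k) f \<longleftrightarrow> f differentiable_on UNIV \<and> (\<forall>i. C_k k (partial_deriv i f))"

text \<open>The space $C_c^\infty(\Omega)$; its elements are extended by zero to the whole space.\<close>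

definition test_functions :: "(real ^ 'n) set \<Rightarrow> (real ^ 'n \<Rightarrow> real) set" where
  "test_functions \<Omega> = {\<psi>. (\<forall>k. C_k k \<psi>) \<and>
     compact (closure {x. \<psi> x \<noteq> 0}) \<and> closure {x. \<psi> x \<noteq> 0} \<subseteq> \<Omega>}"

definition square_integrable_on ::
    "(real ^ 'n \<Rightarrow> 'b::euclidean_space) \<Rightarrow> (real ^ 'n) set \<Rightarrow> bool" where
  "square_integrable_on f \<Omega> \<longleftrightarrow> f \<in> borel_measurable (lebesgue_on \<Omega>) \<and>
     integrable (lebesgue_on \<Omega>) (\<lambda>x. (norm (f x))\<^sup>2)"

text \<open>
  Sobolev functions are given by representatives, only whose values on \<open>\<Omega>\<close> matter.
  Since a weak gradient is determined only almost everywhere, it is a relation between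
  functions: \<open>H1_gradient \<Omega> u g\<close> says that $u \in H^1(\Omega)$ and $\nabla u = g$.
\<close>

definition H1_gradient ::
    "(real ^ 'n) set \<Rightarrow> (real ^ 'n \<Rightarrow> real) \<Rightarrow> (real ^ 'n \<Rightarrow> real ^ 'n) \<Rightarrow> bool" where
  "H1_gradient \<Omega> u g \<longleftrightarrow> square_integrable_on u \<Omega> \<and> square_integrable_on g \<Omega> \<and>
     (\<forall>\<psi>\<in>test_functions \<Omega>. \<forall>i.
        (LINT x|lebesgue_on \<Omega>. u x * partial_deriv i \<psi> x)
          = - (LINT x|lebesgue_on \<Omega>. g x $ i * \<psi> x))"

text \<open>
  \<open>H10_gradient \<Omega> u g\<close> says that $u \in H^1_0(\Omega)$ and $\nabla u = g$, where
  $H^1_0(\Omega)$ is the closure of $C_c^\infty(\Omega)$ in the norm of $H^1(\Omega)$.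
\<close>

definition H10_gradient ::
    "(real ^ 'n) set \<Rightarrow> (real ^ 'n \<Rightarrow> real) \<Rightarrow> (real ^ 'n \<Rightarrow> real ^ 'n) \<Rightarrow> bool" where
  "H10_gradient \<Omega> u g \<longleftrightarrow> H1_gradient \<Omega> u g \<and>
     (\<exists>\<psi> :: nat \<Rightarrow> real ^ 'n \<Rightarrow> real. (\<forall>k. \<psi> k \<in> test_functions \<Omega>) \<and>
        (\<lambda>k. sqrt (LINT x|lebesgue_on \<Omega>.
                (\<psi> k x - u x)\<^sup>2 + (norm (gradient (\<psi> k) x - g x))\<^sup>2)) \<longlonglongrightarrow> 0)"

text \<open>
  In \<open>ennreal\<close> a quotient of a finite number by \<open>\<infinity>\<close> is 0. For a non-empty open set \<open>\<Omega>\<close>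
  and non-empty \<open>\<Sigma> \<subseteq> frontier \<Omega>\<close> the denominator is positive for every
  admissible \<open>u\<close> and the infimum is finite, so \<open>enn2real\<close> loses nothing.
\<close>

definition hardy_quotient ::
    "(real ^ 'n) set \<Rightarrow> (real ^ 'n) set \<Rightarrow> (real ^ 'n \<Rightarrow> real) \<Rightarrow> (real ^ 'n \<Rightarrow> real ^ 'n) \<Rightarrow> ennreal" where
  "hardy_quotient \<Omega> \<Sigma> u g =
     (\<integral>\<^sup>+ x. ennreal ((norm (g x))\<^sup>2) \<partial>lebesgue_on \<Omega>) /
     (\<integral>\<^sup>+ x. ennreal ((u x)\<^sup>2 / (infdist x \<Sigma>)\<^sup>2) \<partial>lebesgue_on \<Omega>)"

definition hardy_constant :: "(real ^ 'n) set \<Rightarrow> (real ^ 'n) set \<Rightarrow> real" where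
  "hardy_constant \<Omega> \<Sigma> = enn2real
     (Inf {hardy_quotient \<Omega> \<Sigma> u g | u g.
        H10_gradient \<Omega> u g \<and> \<not> (AE x in lebesgue_on \<Omega>. u x = 0)})"

definition C1_map :: "(real ^ 'n \<Rightarrow> real ^ 'n) \<Rightarrow> bool" where
  "C1_map \<phi> \<longleftrightarrow> \<phi> differentiable_on UNIV \<and> continuous_on UNIV (\<lambda>x. jacobian \<phi> (at x))"

definition C1_diffeomorphism :: "(real ^ 'n \<Rightarrow> real ^ 'n) \<Rightarrow> bool" where
  "C1_diffeomorphism \<phi> \<longleftrightarrow> bij \<phi> \<and> C1_map \<phi> \<and> C1_map (inv \<phi>)"

text \<open>The norm $\|D\varphi - I\|_{L^\infty(A)}$, which is \<open>\<infinity>\<close> if the supremum is not finite.\<close>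

definition jacobian_deviation :: "(real ^ 'n \<Rightarrow> real ^ 'n) \<Rightarrow> (real ^ 'n) set \<Rightarrow> ennreal" where
  "jacobian_deviation \<phi> A = (SUP x\<in>A. ennreal (onorm ((*v) (jacobian \<phi> (at x) - mat 1))))"

definition co_map :: "(real ^ 'n \<Rightarrow> real ^ 'n) \<Rightarrow> (real ^ 'n) set \<Rightarrow> (real ^ 'n) set" where
  "co_map \<phi> \<Omega> = convex hull \<Omega> \<union> \<phi> -` (convex hull (\<phi> ` \<Omega>))"

end

theory Submission
  imports Defs
begin

text \<open>
  Let $\delta$ be the supremum of $\|D\varphi-I\|$ over the convex hull of $\Omega$. The mean value
  inequality, applied to $\varphi-\mathrm{id}$ on this convex set, gives
  $|\varphi(x)-\varphi(y)-(x-y)|\le\delta|x-y|$ there, and by continuity on the closure of $\Omega$,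
  which contains $\Sigma$. Everything else follows from this one estimate (\<open>near_identity\<close>),
  which the inverse map satisfies on $\varphi(\Omega\cup\Sigma)$ with $2\delta$ in place of $\delta$
  when $\delta\le1/2$. So both maps are Lipschitz with constant $1+2\delta$, and therefore
  distances to $\Sigma$ and to $\varphi(\Sigma)$, lengths of gradients and volumes
  (\<open>near_identity_emeasure_bounded\<close>) all change by factors $1+O(\delta)$ at most.

  If $\psi$ is a test function on $\Omega$, then $\psi\circ\varphi^{-1}$ is a competitor on
  $\varphi(\Omega)$, and its Hardy quotient exceeds that of $\psi$ by a factor $F=1+O(\delta)$ at
  most. Hence $H(\varphi(\Omega),\varphi(\Sigma))\le F\,H(\Omega,\Sigma)$
  (\<open>hardy_infimum_image_le\<close>), and the same statement for $\varphi^{-1}$ gives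
  $H(\Omega,\Sigma)\le F\,H(\varphi(\Omega),\varphi(\Sigma))$. The two inequalities together are
  the claim.

  Two facts about $H^1_0$ make this rigorous. The function $\psi\circ\varphi^{-1}$ is only $C^1$;
  it belongs to $H^1_0$ because a compactly supported $C^1$ function is approximated, together
  with its gradient, by its mollifications (\<open>H10_gradient_C1\<close>). Conversely it suffices to compare
  quotients of test functions, because by Fatou's lemma a Hardy inequality passes from test
  functions to all of $H^1_0$ (\<open>hardy_quotient_test_functions_bound\<close>). Volumes are compared on
  small cubes, whose images lie in slightly larger cubes.
\<close>

section \<open>Gradients of $C^1$ functions\<close>

lemma gradient_nth [simp]: "gradient f x $ i = partial_deriv i f x"
  by (simp add: gradient_def)

lemma partial_deriv_eqI:
  assumes "(f has_derivative (\<lambda>h. v \<bullet> h)) (at x)"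
  shows "partial_deriv i f x = v $ i"
  unfolding partial_deriv_def frechet_derivative_at[OF assms, symmetric] by (simp add: inner_axis)

lemma gradient_eqI:
  assumes "(f has_derivative (\<lambda>h. v \<bullet> h)) (at x)"
  shows "gradient f x = v"
  using partial_deriv_eqI[OF assms] by (simp add: vec_eq_iff)

lemma has_derivative_gradient:
  assumes "f differentiable (at x)"
  shows "(f has_derivative (\<lambda>h. gradient f x \<bullet> h)) (at x)"
proof -
  let ?D = "frechet_derivative f (at x)"
  have D: "(f has_derivative ?D) (at x)"
    using assms frechet_derivative_works by blast
  then have lin: "linear ?D"
    by (rule has_derivative_linear)
  have "?D h = gradient f x \<bullet> h" for h
  proof -
    have "?D h = ?D (\<Sum>i\<in>UNIV. (h $ i) *\<^sub>R axis i 1)"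
      using basis_expansion[of h] by (simp add: scalar_mult_eq_scaleR)
    also have "\<dots> = gradient f x \<bullet> h"
      by (simp add: linear_sum[OF lin] linear_cmul[OF lin] inner_vec_def partial_deriv_def mult.commute)
    finally show ?thesis .
  qed
  then have "?D = (\<lambda>h. gradient f x \<bullet> h)" by auto
  with D show ?thesis by simp
qed

lemma C_k_SucI:
  assumes "\<And>x. (f has_derivative (\<lambda>h. v x \<bullet> h)) (at x)"
    and "\<And>i. C_k k (\<lambda>x. v x $ i)"
  shows "C_k (Suc k) f"
proof -
  have "partial_deriv i f = (\<lambda>x. v x $ i)" for i
    using partial_deriv_eqI[OF assms(1)] by auto
  moreover have "f differentiable_on UNIV"
    using assms(1) unfolding differentiable_on_def differentiable_def by auto
  ultimately show ?thesis using assms(2) by simp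
qed

abbreviation C1 :: "(real ^ 'n \<Rightarrow> real) \<Rightarrow> bool" where
  "C1 \<equiv> C_k (Suc 0)"

lemma C1_derivative:
  "C1 f \<Longrightarrow> (f has_derivative (\<lambda>h. gradient f x \<bullet> h)) (at x)"
  by (rule has_derivative_gradient) (simp add: differentiable_on_def)

lemma C1_continuous: "C1 f \<Longrightarrow> continuous_on UNIV f"
  by (simp add: differentiable_imp_continuous_on)

lemma C1_partial_continuous: "C1 f \<Longrightarrow> continuous_on UNIV (partial_deriv i f)"
  by simp

lemma C1_gradient_continuous: "C1 f \<Longrightarrow> continuous_on UNIV (gradient f)"
  unfolding gradient_def by (intro continuous_on_vec_lambda) simp

lemma C1_I:
  assumes "\<And>x. (f has_derivative (\<lambda>h. v x \<bullet> h)) (at x)" "continuous_on UNIV v"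
  shows "C1 f"
  by (rule C_k_SucI[OF assms(1)]) (auto intro!: continuous_intros assms)

lemma partial_deriv_mult:
  assumes "C1 f" "C1 g"
  shows "partial_deriv i (\<lambda>x. f x * g x) x = partial_deriv i f x * g x + f x * partial_deriv i g x"
proof -
  have "((\<lambda>x. f x * g x) has_derivative (\<lambda>h. (g x *\<^sub>R gradient f x + f x *\<^sub>R gradient g x) \<bullet> h)) (at x)"
    by (rule derivative_eq_intros C1_derivative assms refl)+ (auto simp: inner_simps)
  then show ?thesis by (simp add: partial_deriv_eqI)
qed

lemma C1_mult:
  assumes "C1 f" "C1 g"
  shows "C1 (\<lambda>x. f x * g x)"
proof (rule C1_I)
  show "((\<lambda>x. f x * g x) has_derivative (\<lambda>h. (g x *\<^sub>R gradient f x + f x *\<^sub>R gradient g x) \<bullet> h)) (at x)" for x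
    by (rule derivative_eq_intros C1_derivative assms refl)+ (auto simp: inner_simps)
  show "continuous_on UNIV (\<lambda>x. g x *\<^sub>R gradient f x + f x *\<^sub>R gradient g x)"
    by (intro continuous_intros C1_continuous C1_gradient_continuous assms)
qed

lemma gradient_eq_0:
  assumes "C1 f" "closed K" "\<And>y. y \<notin> K \<Longrightarrow> f y = 0" "x \<notin> K"
  shows "gradient f x = 0"
proof (rule gradient_eqI)
  have "((\<lambda>y. 0) has_derivative (\<lambda>h. 0 \<bullet> h)) (at x)" by simp
  then show "(f has_derivative (\<lambda>h. 0 \<bullet> h)) (at x)"
    by (rule has_derivative_transform_within_open[where s="-K"]) (use assms in auto)
qed

lemma partial_deriv_eq_0:
  assumes "C1 f" "closed K" "\<And>y. y \<notin> K \<Longrightarrow> f y = 0" "x \<notin> K"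
  shows "partial_deriv i f x = 0"
  using gradient_eq_0[OF assms] by (metis gradient_nth zero_index)

section \<open>Integration by parts\<close>

lemma integrable_continuous_compact_support:
  fixes f :: "'a::euclidean_space \<Rightarrow> 'b::euclidean_space"
  assumes "continuous_on UNIV f" "compact K" "\<And>x. x \<notin> K \<Longrightarrow> f x = 0"
  shows "integrable lborel f"
proof -
  have "integrable lborel (\<lambda>x. indicator K x *\<^sub>R f x)"
    using assms by (intro borel_integrable_compact) (auto intro: continuous_on_subset)
  moreover have "(\<lambda>x. indicator K x *\<^sub>R f x) = f"
    using assms(3) by (auto simp: indicator_def fun_eq_iff)
  ultimately show ?thesis by simp
qed

lemma integral_translate:
  fixes f :: "'a::euclidean_space \<Rightarrow> real"
  assumes "f \<in> borel_measurable borel"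
  shows "(LINT y|lborel. f (c + y)) = (LINT y|lborel. f y)"
proof -
  have "(LINT y|lborel. f y) = (LINT y|distr lborel borel ((+) c). f y)"
    by (simp add: lborel_distr_plus)
  also have "\<dots> = (LINT y|lborel. f (c + y))"
    using assms by (intro integral_distr) auto
  finally show ?thesis by simp
qed

lemma integral_cbox_eq_lborel:
  fixes f :: "'a::euclidean_space \<Rightarrow> real"
  assumes "continuous_on UNIV f" "\<And>x. x \<notin> cbox a b \<Longrightarrow> f x = 0"
  shows "integral (cbox a b) f = (LINT x|lborel. f x)"
proof -
  have "(\<lambda>x. if x \<in> cbox a b then f x else 0) = f" using assms(2) by auto
  then have "integral (cbox a b) f = integral UNIV f"
    using Henstock_Kurzweil_Integration.integral_restrict_UNIV[of "cbox a b" f] by simp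
  also have "\<dots> = (LINT x|lborel. f x)"
    using assms by (intro integral_lborel integrable_continuous_compact_support[of f "cbox a b"]) auto
  finally show ?thesis .
qed

text \<open>
  The integral of a translate $f(\cdot+te_i)$ does not depend on $t$. Differentiate at $t=0$ under
  the integral sign; for $|t|<1$ all translates live in one fixed box.
\<close>

lemma integral_partial_deriv_eq_0:
  fixes f :: "real ^ 'n \<Rightarrow> real"
  assumes f: "C1 f" and K: "compact K" "\<And>x. x \<notin> K \<Longrightarrow> f x = 0"
  shows "(LINT x|lborel. partial_deriv i f x) = 0"
proof -
  have cf: "continuous_on UNIV f" and cd: "continuous_on UNIV (partial_deriv i f)"
    by (rule C1_continuous[OF f], rule C1_partial_continuous[OF f])
  obtain R where R: "\<And>x. x \<in> K \<Longrightarrow> norm x \<le> R"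
    using compact_imp_bounded[OF K(1)] unfolding bounded_iff by blast
  obtain a :: "real ^ 'n" where a: "cball 0 (R + 1) \<subseteq> cbox (- a) a"
    using bounded_subset_cbox_symmetric[OF bounded_cball] by blast
  let ?e = "axis i 1 :: real ^ 'n"
  define F where "F t = integral (cbox (- a) a) (\<lambda>y. f (y + t *\<^sub>R ?e))" for t
  have out: "f (y + t *\<^sub>R ?e) = 0" if "y \<notin> cbox (- a) a" "\<bar>t\<bar> < 1" for y t
  proof (rule K(2), rule notI)
    assume "y + t *\<^sub>R ?e \<in> K"
    then have "norm (y + t *\<^sub>R ?e) \<le> R" by (rule R)
    moreover have "norm y \<le> norm (y + t *\<^sub>R ?e) + norm (t *\<^sub>R ?e)"
      using norm_triangle_ineq4[of "y + t *\<^sub>R ?e" "t *\<^sub>R ?e"] by simp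
    moreover have "norm (t *\<^sub>R ?e) < 1" using that by simp
    ultimately have "y \<in> cball 0 (R + 1)" by simp
    with a that(1) show False by blast
  qed
  have const: "F t = (LINT y|lborel. f y)" if "t \<in> {-1<..<1}" for t
  proof -
    have "continuous_on UNIV (\<lambda>y. f (y + t *\<^sub>R ?e))"
      by (intro continuous_on_compose2[OF cf]) (auto intro!: continuous_intros)
    moreover have "f (y + t *\<^sub>R ?e) = 0" if "y \<notin> cbox (- a) a" for y
      using that \<open>t \<in> _\<close> by (intro out) auto
    ultimately have "F t = (LINT y|lborel. f (y + t *\<^sub>R ?e))"
      unfolding F_def by (rule integral_cbox_eq_lborel)
    also have "\<dots> = (LINT y|lborel. f (t *\<^sub>R ?e + y))"
      by (simp add: add.commute)
    also have "\<dots> = (LINT y|lborel. f y)"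
      by (rule integral_translate) (rule borel_measurable_continuous_onI[OF cf])
    finally show ?thesis .
  qed
  have "((\<lambda>t. LINT y|lborel. f y) has_vector_derivative 0) (at 0)" by simp
  then have "(F has_vector_derivative 0) (at 0)"
    by (rule has_vector_derivative_transform_within_open[of _ _ _ "{-1<..<1}"]) (auto simp: const)
  moreover have "(F has_vector_derivative
      integral (cbox (- a) a) (\<lambda>y. partial_deriv i f (y + 0 *\<^sub>R ?e))) (at 0 within {-1<..<1})"
    unfolding F_def
  proof (rule leibniz_rule_vector_derivative)
    fix t :: real and y :: "real ^ 'n"
    have "((\<lambda>t. y + t *\<^sub>R ?e) has_derivative (\<lambda>h. h *\<^sub>R ?e)) (at t within {-1<..<1})"
      by (auto intro!: derivative_eq_intros)
    from has_derivative_compose[OF this C1_derivative[OF f]]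
    show "((\<lambda>t. f (y + t *\<^sub>R ?e)) has_vector_derivative partial_deriv i f (y + t *\<^sub>R ?e)) (at t within {-1<..<1})"
      by (simp add: has_vector_derivative_def inner_axis)
  next
    show "(\<lambda>y. f (y + t *\<^sub>R ?e)) integrable_on cbox (- a) a" for t
      by (intro integrable_continuous continuous_on_compose2[OF cf]) (auto intro!: continuous_intros)
    show "continuous_on ({-1<..<1} \<times> cbox (- a) a) (\<lambda>(t, y). partial_deriv i f (y + t *\<^sub>R ?e))"
      unfolding split_beta by (intro continuous_on_compose2[OF cd]) (auto intro!: continuous_intros)
  qed auto
  then have "(F has_vector_derivative integral (cbox (- a) a) (partial_deriv i f)) (at 0)"
    by (simp add: at_within_open[of _ "{-1<..<1}"])
  ultimately have "integral (cbox (- a) a) (partial_deriv i f) = 0"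
    using vector_derivative_unique_at by blast
  moreover have "partial_deriv i f x = 0" if "x \<notin> cbox (- a) a" for x
  proof (rule partial_deriv_eq_0[OF f compact_imp_closed[OF K(1)] K(2)])
    have "x \<notin> cball 0 (R + 1)" using that a by blast
    then show "x \<notin> K" using R[of x] by auto
  qed
  then have "integral (cbox (- a) a) (partial_deriv i f) = (LINT x|lborel. partial_deriv i f x)"
    by (intro integral_cbox_eq_lborel[OF cd])
  ultimately show ?thesis by simp
qed

lemma integration_by_parts:
  assumes fg: "C1 f" "C1 g" and K: "compact K" "\<And>x. x \<notin> K \<Longrightarrow> f x = 0"
  shows "(LINT x|lborel. f x * partial_deriv i g x) = - (LINT x|lborel. partial_deriv i f x * g x)"
proof -
  have "integrable lborel (\<lambda>x. partial_deriv i f x * g x)" "integrable lborel (\<lambda>x. f x * partial_deriv i g x)"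
    using K partial_deriv_eq_0[OF fg(1) compact_imp_closed[OF K(1)] K(2)]
    by (auto intro!: integrable_continuous_compact_support[of _ K] continuous_on_mult
        fg[THEN C1_continuous] fg[THEN C1_partial_continuous])
  moreover have "(LINT x|lborel. partial_deriv i f x * g x + f x * partial_deriv i g x) = 0"
    using integral_partial_deriv_eq_0[OF C1_mult[OF fg] K(1), of i] K(2)
    by (simp add: partial_deriv_mult[OF fg])
  ultimately show ?thesis by simp
qed

section \<open>Mollifiers\<close>

text \<open>
  For $m=0$ this is the standard smooth function that vanishes to infinite order at 0. The factors
  $t^{-m}$ make the family closed under differentiation up to linear combinations.
\<close>

definition flat :: "nat \<Rightarrow> real \<Rightarrow> real" where
  "flat m t = (if t > 0 then exp (- (1 / t)) * (1 / t) ^ m else 0)"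

lemma power_le_fact_exp: "(s::real) \<ge> 0 \<Longrightarrow> s ^ k \<le> fact k * exp s"
proof -
  assume s: "s \<ge> 0"
  have "s ^ k / fact k \<le> (\<Sum>n. s ^ n / fact n)"
    using sum_le_suminf[of "\<lambda>n. s ^ n / fact n" "{k}"] summable_exp_generic[of s] s
    by (simp add: divide_inverse scaleR_conv_of_real mult.commute)
  also have "\<dots> = exp s"
    by (simp add: exp_def divide_inverse scaleR_conv_of_real mult.commute)
  finally show ?thesis by (simp add: field_simps)
qed

text \<open>
  A quadratic bound is what forces the derivative at 0 to vanish.
\<close>

lemma flat_bound: "\<bar>flat m t\<bar> \<le> fact (m + 2) * t\<^sup>2"
proof (cases "t > 0")
  case True
  have "(1 / t) ^ (m + 2) \<le> fact (m + 2) * exp (1 / t)"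
    using True by (intro power_le_fact_exp) auto
  then have "(1 / t) ^ m * (1 / t)\<^sup>2 \<le> fact (m + 2) * exp (1 / t)"
    by (simp only: power_add)
  then have "exp (- (1 / t)) * (1 / t) ^ m \<le> fact (m + 2) * t\<^sup>2"
    using True by (simp add: exp_minus power_one_over field_simps del: fact_Suc add_2_eq_Suc')
  then show ?thesis
    using True by (simp add: flat_def del: fact_Suc add_2_eq_Suc')
qed (simp add: flat_def)

lemma flat_has_derivative:
  "(flat m has_real_derivative (flat (m + 2) t - real m * flat (m + 1) t)) (at t)"
proof -
  consider "t > 0" | "t < 0" | "t = 0" by linarith
  then show ?thesis
  proof cases
    case 1
    have inv: "((\<lambda>t. 1 / t) has_real_derivative - ((1 / t) * (1 / t))) (at t)"
      using 1 by (auto intro!: derivative_eq_intros)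
    have "((\<lambda>t. exp (- (1 / t)) * (1 / t) ^ m) has_real_derivative
            (flat (m + 2) t - real m * flat (m + 1) t)) (at t)"
      by (rule derivative_eq_intros inv refl)+
         (use 1 in \<open>cases m; auto simp: flat_def algebra_simps\<close>)
    then show ?thesis
      by (rule has_field_derivative_transform_within_open[where S="{0<..}"])
         (use 1 in \<open>auto simp: flat_def\<close>)
  next
    case 2
    have "((\<lambda>t. 0) has_real_derivative (flat (m + 2) t - real m * flat (m + 1) t)) (at t)"
      using 2 by (auto simp: flat_def)
    then show ?thesis
      by (rule has_field_derivative_transform_within_open[where S="{..<0}"])
         (use 2 in \<open>auto simp: flat_def\<close>)
  next
    case 3
    have "((\<lambda>h. flat m h / h) \<longlongrightarrow> 0) (at 0)"
    proof (rule Lim_null_comparison)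
      have "\<bar>flat m h\<bar> \<le> fact (m + 2) * \<bar>h\<bar> * \<bar>h\<bar>" for h
        using flat_bound[of m h] by (simp only: mult.assoc abs_mult_self_eq power2_eq_square)
      then show "eventually (\<lambda>h. norm (flat m h / h) \<le> fact (m + 2) * \<bar>h\<bar>) (at 0)"
        by (auto simp: eventually_at_filter divide_le_eq simp del: fact_Suc add_2_eq_Suc' intro!: always_eventually)
      show "((\<lambda>h::real. fact (m + 2) * \<bar>h\<bar>) \<longlongrightarrow> 0) (at 0)"
        by (auto intro!: tendsto_eq_intros)
    qed
    then show ?thesis using 3 by (simp add: DERIV_def flat_def)
  qed
qed

text \<open>
  Products of polynomials with $\exp(-1/(s-|x|^2))\,(s-|x|^2)^{-m}$ on the ball of radius $\sqrt s$,
  and their sums. Smoothness of the bump function is proved by exhibiting a class of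
  differentiable functions that contains it and is closed under partial derivatives; this is such a
  class.
\<close>

inductive bumplike :: "real \<Rightarrow> (real ^ 'n \<Rightarrow> real) \<Rightarrow> bool" for s where
  base: "bumplike s (\<lambda>x. flat m (s - x \<bullet> x))"
| coord: "bumplike s g \<Longrightarrow> bumplike s (\<lambda>x. x $ i * g x)"
| scale: "bumplike s g \<Longrightarrow> bumplike s (\<lambda>x. c * g x)"
| add: "bumplike s g \<Longrightarrow> bumplike s h \<Longrightarrow> bumplike s (\<lambda>x. g x + h x)"

lemma bumplike_derivative:
  fixes g :: "real ^ 'n \<Rightarrow> real"
  assumes "bumplike s g"
  shows "\<exists>v. (\<forall>x. (g has_derivative (\<lambda>h. v x \<bullet> h)) (at x)) \<and> (\<forall>i. bumplike s (\<lambda>x. v x $ i))"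
  using assms
proof induction
  case (base m)
  let ?d = "\<lambda>x. flat (m + 2) (s - x \<bullet> x) - real m * flat (m + 1) (s - x \<bullet> x)"
  have "((\<lambda>x. flat m (s - x \<bullet> x)) has_derivative (\<lambda>h. ((- 2 * ?d x) *\<^sub>R x) \<bullet> h)) (at x)" for x :: "real^'n"
  proof -
    have "((\<lambda>x. s - x \<bullet> x) has_derivative (\<lambda>h. - 2 * (x \<bullet> h))) (at x)"
      by (auto intro!: derivative_eq_intros simp: inner_commute)
    from has_derivative_compose[OF this flat_has_derivative[unfolded has_field_derivative_def]]
    show ?thesis
      by (rule has_derivative_eq_rhs) (auto simp: algebra_simps)
  qed
  moreover have "bumplike s (\<lambda>x. ((- 2 * ?d x) *\<^sub>R x) $ i)" for i :: 'n
  proof -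
    have "bumplike s (\<lambda>x::real^'n. x $ i * ((-2) * flat (m + 2) (s - x \<bullet> x) + (2 * real m) * flat (m + 1) (s - x \<bullet> x)))"
      by (intro bumplike.intros)
    moreover have "(\<lambda>x::real^'n. x $ i * ((-2) * flat (m + 2) (s - x \<bullet> x) + (2 * real m) * flat (m + 1) (s - x \<bullet> x)))
      = (\<lambda>x. ((- 2 * ?d x) *\<^sub>R x) $ i)"
      by (auto simp: algebra_simps)
    ultimately show ?thesis by simp
  qed
  ultimately show ?case by (intro exI[of _ "\<lambda>x. (- 2 * ?d x) *\<^sub>R x"]) blast
next
  case (coord g i)
  then obtain v where v: "\<And>x. (g has_derivative (\<lambda>h. v x \<bullet> h)) (at x)" "\<And>j. bumplike s (\<lambda>x. v x $ j)"
    by blast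
  let ?w = "\<lambda>x. g x *\<^sub>R axis i 1 + (x $ i) *\<^sub>R v x"
  have "((\<lambda>x. x $ i * g x) has_derivative (\<lambda>h. ?w x \<bullet> h)) (at x)" for x
    by (rule derivative_eq_intros v bounded_linear_imp_has_derivative[OF bounded_linear_vec_nth] refl)+
       (auto simp: inner_simps inner_axis' mult_ac)
  moreover have "bumplike s (\<lambda>x. ?w x $ j)" for j
  proof -
    have "bumplike s (\<lambda>x. (if j = i then 1 else 0) * g x + x $ i * v x $ j)"
      by (intro bumplike.intros v coord)
    moreover have "(\<lambda>x. (if j = i then 1 else 0) * g x + x $ i * v x $ j) = (\<lambda>x. ?w x $ j)"
      by (auto simp: axis_def)
    ultimately show ?thesis by simp
  qed
  ultimately show ?case by (intro exI[of _ ?w]) blast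
next
  case (scale g c)
  then obtain v where v: "\<And>x. (g has_derivative (\<lambda>h. v x \<bullet> h)) (at x)" "\<And>j. bumplike s (\<lambda>x. v x $ j)"
    by blast
  show ?case
    by (rule exI[of _ "\<lambda>x. c *\<^sub>R v x"])
       (use v in \<open>auto intro!: derivative_eq_intros bumplike.intros simp: inner_simps\<close>)
next
  case (add g h)
  then obtain v w where v: "\<And>x. (g has_derivative (\<lambda>h. v x \<bullet> h)) (at x)" "\<And>j. bumplike s (\<lambda>x. v x $ j)"
    and w: "\<And>x. (h has_derivative (\<lambda>h. w x \<bullet> h)) (at x)" "\<And>j. bumplike s (\<lambda>x. w x $ j)"
    by blast
  show ?case
    by (rule exI[of _ "\<lambda>x. v x + w x"])
       (use v w in \<open>auto intro!: derivative_eq_intros bumplike.intros simp: inner_simps\<close>)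
qed

lemma bumplike_C_k: "bumplike s g \<Longrightarrow> C_k k g"
proof (induction k arbitrary: g)
  case 0
  obtain v where "\<And>x. (g has_derivative (\<lambda>h. v x \<bullet> h)) (at x)"
    using bumplike_derivative[OF 0] by blast
  then have "continuous_on UNIV g"
    by (intro continuous_at_imp_continuous_on) (auto intro: has_derivative_continuous)
  then show ?case by simp
next
  case (Suc k)
  then show ?case using bumplike_derivative[OF Suc.prems] C_k_SucI by metis
qed

text \<open>
  The evenness is used to write the integral of \<open>\<rho> (x - y)\<close> over \<open>y\<close> as that of a translate of
  \<open>\<rho>\<close>.
\<close>

lemma mollifier_exists:
  assumes "e > 0"
  obtains \<rho> :: "real ^ 'n \<Rightarrow> real"
    where "\<And>k. C_k k \<rho>" "\<And>x. \<rho> x \<ge> 0" "\<And>x. \<rho> (- x) = \<rho> x" "\<And>x. norm x > e \<Longrightarrow> \<rho> x = 0"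
      "(LINT x|lborel. \<rho> x) = 1"
proof -
  define g :: "real^'n \<Rightarrow> real" where "g x = flat 0 (e\<^sup>2 - x \<bullet> x)" for x
  have bump: "bumplike (e\<^sup>2) g" unfolding g_def by (rule bumplike.base)
  have nn: "g x \<ge> 0" for x by (simp add: g_def flat_def)
  have g0: "g x = 0" if "norm x > e" for x
  proof -
    have "e\<^sup>2 < (norm x)\<^sup>2" using that assms by (intro power_strict_mono) auto
    then show ?thesis by (simp add: g_def flat_def power2_norm_eq_inner)
  qed
  have cont: "continuous_on UNIV g" using bumplike_C_k[OF bump, of 0] by simp
  have int: "integrable lborel g"
    by (rule integrable_continuous_compact_support[OF cont, of "cball 0 e"]) (auto intro: g0)
  define c where "c = (LINT x|lborel. g x)"
  have "c \<ge> 0" unfolding c_def using nn by (intro integral_nonneg_AE) auto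
  moreover have "c \<noteq> 0"
  proof
    assume "c = 0"
    then have "AE x in lborel. g x = 0"
      using integral_nonneg_eq_0_iff_AE[OF int] nn by (simp add: c_def)
    moreover have "x \<notin> ball 0 e" if elim: "g x = 0" for x
    proof -
      have "(norm x)\<^sup>2 < e\<^sup>2" if "norm x < e" using that by (intro power_strict_mono) auto
      with elim show ?thesis by (auto simp: g_def flat_def power2_norm_eq_inner split: if_splits)
    qed
    ultimately have "AE x in lborel. x \<notin> ball (0::real^'n) e"
      by (auto elim: eventually_mono)
    then have "emeasure lborel (ball (0::real^'n) e) = 0"
      by (subst (asm) AE_iff_measurable[OF _ refl]) (auto simp: ball_def)
    then have "negligible (ball (0::real^'n) e)"
      unfolding negligible_iff_null_sets by (intro null_sets_completionI) (simp add: null_sets_def)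
    then show False
      using assms open_not_negligible[of "ball (0::real^'n) e"] by auto
  qed
  ultimately have c: "c > 0" by simp
  show thesis
  proof (rule that[of "\<lambda>x. (1 / c) * g x"])
    show "C_k k (\<lambda>x. (1 / c) * g x)" for k
      by (rule bumplike_C_k[of "e\<^sup>2"]) (intro bumplike.scale bump)
    show "(LINT x|lborel. (1 / c) * g x) = 1"
      using c by (simp add: c_def)
  qed (use c nn g0 in \<open>auto simp: g_def\<close>)
qed

section \<open>Convolution with a mollifier\<close>

definition convolution :: "(real ^ 'n \<Rightarrow> real) \<Rightarrow> (real ^ 'n \<Rightarrow> real) \<Rightarrow> real ^ 'n \<Rightarrow> real" where
  "convolution \<rho> w x = (LINT y|lborel. \<rho> (x - y) * w y)"

text \<open>
  Differentiation under the integral sign puts the derivative on the kernel. This is why convolution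
  with a smooth kernel smooths a function \<open>w\<close> that is merely continuous.
\<close>

lemma convolution_has_derivative:
  fixes \<rho> w :: "real ^ 'n \<Rightarrow> real"
  assumes \<rho>: "C1 \<rho>" and w: "continuous_on UNIV w" and K: "compact K" "\<And>x. x \<notin> K \<Longrightarrow> w x = 0"
  shows "(convolution \<rho> w has_derivative
           (\<lambda>h. (\<chi> i. convolution (partial_deriv i \<rho>) w x) \<bullet> h)) (at x)"
proof -
  obtain a where a: "K \<subseteq> cbox (- a) a"
    using bounded_subset_cbox_symmetric[OF compact_imp_bounded[OF K(1)]] by blast
  have out: "w y = 0" if "y \<notin> cbox (- a) a" for y using K(2) a that by auto
  have c\<rho>: "continuous_on UNIV \<rho>" and cg: "continuous_on UNIV (gradient \<rho>)"
    and cp: "\<And>i. continuous_on UNIV (partial_deriv i \<rho>)"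
    by (rule C1_continuous[OF \<rho>], rule C1_gradient_continuous[OF \<rho>], rule C1_partial_continuous[OF \<rho>])
  have conv: "convolution k w x = integral (cbox (- a) a) (\<lambda>y. k (x - y) * w y)"
    if "continuous_on UNIV k" for k x
    unfolding convolution_def using out
    by (intro integral_cbox_eq_lborel[symmetric] continuous_on_mult w continuous_on_compose2[OF that])
       (auto intro!: continuous_intros)
  let ?v = "\<lambda>x y. w y *\<^sub>R gradient \<rho> (x - y)"
  have cv: "continuous_on S (\<lambda>(x, y). ?v x y)" for S
    unfolding split_beta
    by (intro continuous_on_scaleR continuous_on_compose2[OF w] continuous_on_compose2[OF cg])
       (auto intro!: continuous_intros)
  have cvx: "continuous_on S (?v x)" for S x
    by (intro continuous_on_scaleR continuous_on_compose2[OF w] continuous_on_compose2[OF cg])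
       (auto intro!: continuous_intros)
  have "((\<lambda>x. integral (cbox (- a) a) (\<lambda>y. \<rho> (x - y) * w y)) has_derivative
      integral (cbox (- a) a) (\<lambda>y. blinfun_inner_right (?v x y))) (at x within UNIV)"
  proof (rule leibniz_rule)
    fix x y :: "real ^ 'n"
    have "((\<lambda>x. x - y) has_derivative (\<lambda>h. h)) (at x)" by (auto intro!: derivative_eq_intros)
    from has_derivative_compose[OF this C1_derivative[OF \<rho>]]
    show "((\<lambda>x. \<rho> (x - y) * w y) has_derivative blinfun_inner_right (?v x y)) (at x)"
      by (auto intro!: derivative_eq_intros simp: mult.commute)
  next
    show "(\<lambda>y. \<rho> (x - y) * w y) integrable_on cbox (- a) a" for x
      by (intro integrable_continuous continuous_on_mult continuous_on_compose2[OF w] continuous_on_compose2[OF c\<rho>])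
         (auto intro!: continuous_intros)
    show "continuous_on (UNIV \<times> cbox (- a) a) (\<lambda>(x, y). blinfun_inner_right (?v x y))"
      using bounded_linear.continuous_on[OF bounded_linear_blinfun_inner_right cv]
      by (simp add: split_beta)
  qed auto
  moreover have "integral (cbox (- a) a) (\<lambda>y. blinfun_inner_right (?v x y))
      = blinfun_inner_right (integral (cbox (- a) a) (?v x))"
    using integral_linear[OF integrable_continuous[OF cvx] bounded_linear_blinfun_inner_right]
    by (simp add: o_def)
  moreover have "integral (cbox (- a) a) (?v x) = (\<chi> i. convolution (partial_deriv i \<rho>) w x)"
    by (simp add: vec_eq_iff conv[OF cp] integral_component_eq_cart[OF integrable_continuous[OF cvx], symmetric]
        mult.commute del: integral_component_eq_cart)
  moreover have "(\<lambda>x. integral (cbox (- a) a) (\<lambda>y. \<rho> (x - y) * w y)) = convolution \<rho> w"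
    using conv[OF c\<rho>] by auto
  ultimately show ?thesis by simp
qed

lemma convolution_continuous:
  fixes \<rho> w :: "real ^ 'n \<Rightarrow> real"
  assumes \<rho>: "continuous_on UNIV \<rho>" and w: "continuous_on UNIV w"
    and K: "compact K" "\<And>x. x \<notin> K \<Longrightarrow> w x = 0"
  shows "continuous_on UNIV (convolution \<rho> w)"
proof -
  obtain a where a: "K \<subseteq> cbox (- a) a"
    using bounded_subset_cbox_symmetric[OF compact_imp_bounded[OF K(1)]] by blast
  have "convolution \<rho> w = (\<lambda>x. integral (cbox (- a) a) (\<lambda>y. \<rho> (x - y) * w y))"
    unfolding convolution_def fun_eq_iff using K(2) a
    by (intro allI integral_cbox_eq_lborel[symmetric] continuous_on_mult w continuous_on_compose2[OF \<rho>])
       (auto intro!: continuous_intros)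
  moreover have "continuous_on UNIV (\<lambda>x. integral (cbox (- a) a) (\<lambda>y. \<rho> (x - y) * w y))"
    unfolding split_beta
    by (intro integral_continuous_on_param)
       (auto simp: split_beta intro!: continuous_on_mult continuous_on_compose2[OF w] continuous_on_compose2[OF \<rho>] continuous_intros)
  ultimately show ?thesis by simp
qed

lemma convolution_C_k:
  assumes "C_k k \<rho>" "continuous_on UNIV w" "compact K" "\<And>x. x \<notin> K \<Longrightarrow> w x = 0"
  shows "C_k k (convolution \<rho> w)"
  using assms(1)
proof (induction k arbitrary: \<rho>)
  case 0
  then show ?case using convolution_continuous[OF _ assms(2-4)] by simp
next
  case (Suc k)
  have "C1 \<rho>" using Suc.prems by (cases k) (auto intro: differentiable_imp_continuous_on)
  show ?case
  proof (rule C_k_SucI)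
    show "(convolution \<rho> w has_derivative (\<lambda>h. (\<chi> i. convolution (partial_deriv i \<rho>) w x) \<bullet> h)) (at x)" for x
      by (rule convolution_has_derivative[OF \<open>C1 \<rho>\<close> assms(2-4)])
    show "C_k k (\<lambda>x. (\<chi> i. convolution (partial_deriv i \<rho>) w x) $ i)" for i
      using Suc by simp
  qed
qed

text \<open>
  Integration by parts moves the derivative from the kernel to \<open>w\<close>. Hence gradients of
  mollifications are mollifications of the gradient, and converge uniformly as well.
\<close>

lemma partial_deriv_convolution:
  fixes w :: "real ^ 'n \<Rightarrow> real"
  assumes \<rho>: "C1 \<rho>" and w: "C1 w" and K: "compact K" "\<And>x. x \<notin> K \<Longrightarrow> w x = 0"
  shows "partial_deriv i (convolution \<rho> w) x = convolution \<rho> (partial_deriv i w) x"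
proof -
  have d: "((\<lambda>y. \<rho> (x - y)) has_derivative (\<lambda>h. (- gradient \<rho> (x - y)) \<bullet> h)) (at y)" for y
  proof -
    have "((\<lambda>y. x - y) has_derivative (\<lambda>h. - h)) (at y)" by (auto intro!: derivative_eq_intros)
    from has_derivative_compose[OF this C1_derivative[OF \<rho>]] show ?thesis by simp
  qed
  have C1: "C1 (\<lambda>y. \<rho> (x - y))"
    by (rule C1_I[OF d])
       (auto intro!: continuous_intros continuous_on_compose2[OF C1_gradient_continuous[OF \<rho>]])
  have "partial_deriv i (convolution \<rho> w) x = convolution (partial_deriv i \<rho>) w x"
    by (simp add: partial_deriv_eqI[OF convolution_has_derivative[OF \<rho> C1_continuous[OF w] K]])
  also have "\<dots> = - (LINT y|lborel. w y * partial_deriv i (\<lambda>y. \<rho> (x - y)) y)"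
    by (simp add: convolution_def partial_deriv_eqI[OF d] mult.commute)
  also have "\<dots> = (LINT y|lborel. partial_deriv i w y * \<rho> (x - y))"
    by (simp add: integration_by_parts[OF w C1 K])
  finally show ?thesis by (simp add: convolution_def mult.commute)
qed

lemma convolution_eq_0:
  assumes "\<And>x. norm x > e \<Longrightarrow> \<rho> x = 0" "\<And>y. y \<in> K \<Longrightarrow> dist x y > e" "\<And>x. x \<notin> K \<Longrightarrow> w x = 0"
  shows "convolution \<rho> w x = 0"
proof -
  have "\<rho> (x - y) * w y = 0" for y
    using assms by (cases "y \<in> K") (auto simp: dist_norm)
  then have eq: "(\<lambda>y. \<rho> (x - y) * w y) = (\<lambda>_. 0)" by blast
  show ?thesis unfolding convolution_def eq by simp
qed

text \<open>
  Since \<open>\<rho>\<close> is a probability density supported in the ball of radius \<open>e\<close>, the convolution at \<open>x\<close>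
  is an average of values of \<open>w\<close> over that ball around \<open>x\<close>.
\<close>

lemma convolution_approx:
  fixes w :: "real ^ 'n \<Rightarrow> real"
  assumes \<rho>: "continuous_on UNIV \<rho>" "\<And>x. \<rho> x \<ge> 0" "\<And>x. \<rho> (- x) = \<rho> x"
    "\<And>x. norm x > e \<Longrightarrow> \<rho> x = 0" "(LINT x|lborel. \<rho> x) = 1"
    and w: "continuous_on UNIV w" "\<And>y. dist x y \<le> e \<Longrightarrow> \<bar>w y - w x\<bar> \<le> \<eta>"
  shows "\<bar>convolution \<rho> w x - w x\<bar> \<le> \<eta>"
proof -
  have c: "continuous_on UNIV (\<lambda>y. \<rho> (x - y))"
    by (intro continuous_on_compose2[OF \<rho>(1)]) (auto intro!: continuous_intros)
  have z: "\<rho> (x - y) = 0" if "y \<notin> cball x e" for y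
    using that by (intro \<rho>(4)) (simp add: dist_norm)
  have int: "integrable lborel (\<lambda>y. \<rho> (x - y) * g y)" if "continuous_on UNIV g" for g
    by (rule integrable_continuous_compact_support[of _ "cball x e"])
       (use z that in \<open>auto intro!: continuous_on_mult c\<close>)
  have "(LINT y|lborel. \<rho> (x - y)) = (LINT y|lborel. \<rho> (- x + y))"
    using \<rho>(3) by (metis add.commute diff_conv_add_uminus minus_diff_eq)
  also have "\<dots> = 1"
    by (simp only: integral_translate[OF borel_measurable_continuous_onI[OF \<rho>(1)]] \<rho>(5))
  finally have one: "(LINT y|lborel. \<rho> (x - y)) = 1" .
  have "convolution \<rho> w x - w x = (LINT y|lborel. \<rho> (x - y) * w y) - (LINT y|lborel. \<rho> (x - y) * w x)"
    by (simp add: convolution_def one)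
  also have "\<dots> = (LINT y|lborel. \<rho> (x - y) * (w y - w x))"
    using int[OF w(1)] int[of "\<lambda>_. w x"] by (simp add: right_diff_distrib)
  also have "\<bar>\<dots>\<bar> \<le> (LINT y|lborel. \<rho> (x - y) * \<eta>)"
  proof (rule order_trans[OF integral_abs_bound], rule integral_mono)
    show "integrable lborel (\<lambda>y. \<bar>\<rho> (x - y) * (w y - w x)\<bar>)"
      by (intro integrable_abs int continuous_intros w)
    show "integrable lborel (\<lambda>y. \<rho> (x - y) * \<eta>)" by (intro int continuous_intros)
    show "\<bar>\<rho> (x - y) * (w y - w x)\<bar> \<le> \<rho> (x - y) * \<eta>" for y
      using z[of y] w(2)[of y] \<rho>(2)[of "x - y"]
      by (cases "y \<in> cball x e") (auto simp: abs_mult intro: mult_left_mono)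
  qed
  also have "\<dots> = \<eta>" by (simp add: one)
  finally show ?thesis .
qed

lemma compact_support_uniformly_continuous:
  fixes w :: "'a::euclidean_space \<Rightarrow> 'b::real_normed_vector"
  assumes "continuous_on UNIV w" "compact K" "\<And>x. x \<notin> K \<Longrightarrow> w x = 0" "e > 0"
  obtains d where "d > 0" "\<And>x x'. dist x' x < d \<Longrightarrow> dist (w x') (w x) < e"
proof -
  obtain R where R: "\<And>x. x \<in> K \<Longrightarrow> norm x \<le> R"
    using compact_imp_bounded[OF assms(2)] unfolding bounded_iff by blast
  have "uniformly_continuous_on (cball 0 (R + 1)) w"
    by (rule compact_uniformly_continuous) (auto intro: continuous_on_subset[OF assms(1)])
  then obtain d where d: "d > 0" "\<And>x x'. x \<in> cball 0 (R + 1) \<Longrightarrow> x' \<in> cball 0 (R + 1) \<Longrightarrow> dist x' x < d \<Longrightarrow> dist (w x') (w x) < e"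
    using assms(4) unfolding uniformly_continuous_on_def by blast
  show thesis
  proof (rule that[of "min d 1"])
    fix x x' :: 'a assume *: "dist x' x < min d 1"
    show "dist (w x') (w x) < e"
    proof (cases "x \<in> cball 0 (R + 1) \<and> x' \<in> cball 0 (R + 1)")
      case True
      then show ?thesis using d(2) * by auto
    next
      case False
      have "norm x \<le> norm x' + dist x' x" "norm x' \<le> norm x + dist x' x"
        using norm_triangle_sub[of x x'] norm_triangle_sub[of x' x]
        by (simp_all add: dist_norm norm_minus_commute)
      with False * have "norm x > R" "norm x' > R" by auto
      then have "x \<notin> K" "x' \<notin> K" using R[of x] R[of x'] by auto
      then show ?thesis using assms(3)[of x] assms(3)[of x'] assms(4) by simp
    qed
  qed (use d(1) in simp)
qed

section \<open>Compactly supported $C^1$ functions belong to $H^1_0$\<close>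

lemma borel_measurable_lebesgue_on_borel:
  "f \<in> borel_measurable borel \<Longrightarrow> f \<in> borel_measurable (lebesgue_on S)"
  by (intro measurable_restrict_space1 measurable_completion) simp

lemma integrable_lebesgue_on_iff:
  fixes f :: "'a::euclidean_space \<Rightarrow> real"
  assumes "open S" "f \<in> borel_measurable borel" "\<And>x. x \<notin> S \<Longrightarrow> f x = 0"
  shows "integrable (lebesgue_on S) f \<longleftrightarrow> integrable lborel f"
proof -
  have "(\<lambda>x. indicator S x *\<^sub>R f x) = f" using assms(3) by (auto simp: indicator_def fun_eq_iff)
  then show ?thesis
    using assms by (simp add: integrable_restrict_space integrable_completion)
qed

lemma integral_lebesgue_on_eq:
  fixes f :: "'a::euclidean_space \<Rightarrow> real"
  assumes "open S" "f \<in> borel_measurable borel" "\<And>x. x \<notin> S \<Longrightarrow> f x = 0"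
  shows "(LINT x|lebesgue_on S. f x) = (LINT x|lborel. f x)"
proof -
  have "(\<lambda>x. indicator S x *\<^sub>R f x) = f" using assms(3) by (auto simp: indicator_def fun_eq_iff)
  then show ?thesis
    using assms by (simp add: integral_restrict_space integral_completion)
qed

lemma test_functionsI:
  assumes "\<And>k. C_k k \<psi>" "compact K" "K \<subseteq> \<Omega>" "\<And>x. x \<notin> K \<Longrightarrow> \<psi> x = 0"
  shows "\<psi> \<in> test_functions \<Omega>"
proof -
  have "closure {x. \<psi> x \<noteq> 0} \<subseteq> K"
    using assms(4) compact_imp_closed[OF assms(2)] by (intro closure_minimal) auto
  moreover from this have "compact (closure {x. \<psi> x \<noteq> 0})"
    using compact_Int_closed[OF assms(2), of "closure {x. \<psi> x \<noteq> 0}"] by (simp add: inf.absorb2)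
  ultimately show ?thesis
    using assms(1,3) by (auto simp: test_functions_def)
qed

lemma test_functionsE:
  assumes "\<psi> \<in> test_functions \<Omega>"
  obtains K where "\<And>k. C_k k \<psi>" "compact K" "K \<subseteq> \<Omega>" "\<And>x. x \<notin> K \<Longrightarrow> \<psi> x = 0"
proof
  show "C_k k \<psi>" for k using assms by (simp add: test_functions_def)
  show "compact (closure {x. \<psi> x \<noteq> 0})" "closure {x. \<psi> x \<noteq> 0} \<subseteq> \<Omega>"
    using assms by (simp_all add: test_functions_def)
  show "x \<notin> closure {x. \<psi> x \<noteq> 0} \<Longrightarrow> \<psi> x = 0" for x
    using closure_subset[of "{x. \<psi> x \<noteq> 0}"] by blast
qed

lemma square_integrable_on_compact_support:
  fixes f :: "real ^ 'n \<Rightarrow> 'b::euclidean_space"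
  assumes "open \<Omega>" "continuous_on UNIV f" "compact K" "K \<subseteq> \<Omega>" "\<And>x. x \<notin> K \<Longrightarrow> f x = 0"
  shows "square_integrable_on f \<Omega>"
  unfolding square_integrable_on_def
proof
  show "f \<in> borel_measurable (lebesgue_on \<Omega>)"
    by (intro borel_measurable_lebesgue_on_borel borel_measurable_continuous_onI assms)
  have c: "continuous_on UNIV (\<lambda>x. (norm (f x))\<^sup>2)" by (intro continuous_intros assms)
  show "integrable (lebesgue_on \<Omega>) (\<lambda>x. (norm (f x))\<^sup>2)"
  proof (subst integrable_lebesgue_on_iff[OF assms(1)])
    show "integrable lborel (\<lambda>x. (norm (f x))\<^sup>2)"
      using assms by (intro integrable_continuous_compact_support[OF c, of K]) auto
    show "(\<lambda>x. (norm (f x))\<^sup>2) \<in> borel_measurable borel"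
      by (rule borel_measurable_continuous_onI[OF c])
    show "(norm (f x))\<^sup>2 = 0" if "x \<notin> \<Omega>" for x
      using that assms(4,5) by auto
  qed
qed

lemma H1_gradient_C1:
  fixes w :: "real ^ 'n \<Rightarrow> real"
  assumes \<Omega>: "open \<Omega>" and w: "C1 w" and K: "compact K" "K \<subseteq> \<Omega>" "\<And>x. x \<notin> K \<Longrightarrow> w x = 0"
  shows "H1_gradient \<Omega> w (gradient w)"
  unfolding H1_gradient_def
proof (intro conjI ballI allI)
  have g0: "gradient w x = 0" if "x \<notin> K" for x
    by (rule gradient_eq_0[OF w compact_imp_closed[OF K(1)] K(3) that])
  show "square_integrable_on w \<Omega>"
    using K(3) by (rule square_integrable_on_compact_support[OF \<Omega> C1_continuous[OF w] K(1,2)])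
  show "square_integrable_on (gradient w) \<Omega>"
    using g0 by (rule square_integrable_on_compact_support[OF \<Omega> C1_gradient_continuous[OF w] K(1,2)])
  fix \<psi> i assume "\<psi> \<in> test_functions \<Omega>"
  then have \<psi>: "C1 \<psi>" unfolding test_functions_def by blast
  have "(LINT x|lebesgue_on \<Omega>. w x * partial_deriv i \<psi> x) = (LINT x|lborel. w x * partial_deriv i \<psi> x)"
  proof (rule integral_lebesgue_on_eq[OF \<Omega>])
    show "(\<lambda>x. w x * partial_deriv i \<psi> x) \<in> borel_measurable borel"
      by (intro borel_measurable_continuous_onI continuous_on_mult C1_continuous[OF w] C1_partial_continuous[OF \<psi>])
    show "w x * partial_deriv i \<psi> x = 0" if "x \<notin> \<Omega>" for x
      using K(2) K(3)[of x] that by auto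
  qed
  also have "\<dots> = - (LINT x|lborel. partial_deriv i w x * \<psi> x)"
    using K(3) by (rule integration_by_parts[OF w \<psi> K(1)])
  also have "(LINT x|lborel. partial_deriv i w x * \<psi> x) = (LINT x|lebesgue_on \<Omega>. partial_deriv i w x * \<psi> x)"
  proof (rule integral_lebesgue_on_eq[OF \<Omega>, symmetric])
    show "(\<lambda>x. partial_deriv i w x * \<psi> x) \<in> borel_measurable borel"
      by (intro borel_measurable_continuous_onI continuous_on_mult C1_continuous[OF \<psi>] C1_partial_continuous[OF w])
    show "partial_deriv i w x * \<psi> x = 0" if "x \<notin> \<Omega>" for x
      using K(2) g0[of x] that by (metis gradient_nth mult_zero_left subsetD zero_index)
  qed
  finally show "(LINT x|lebesgue_on \<Omega>. w x * partial_deriv i \<psi> x) = - (LINT x|lebesgue_on \<Omega>. gradient w x $ i * \<psi> x)"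
    by simp
qed

lemma C1_uniform_approximation:
  fixes w :: "real ^ 'n \<Rightarrow> real"
  assumes w: "C1 w" and K: "compact K" "\<And>x. x \<notin> K \<Longrightarrow> w x = 0" and pos: "\<eta> > 0" "\<delta> > 0"
  obtains \<psi> where "\<And>k. C_k k \<psi>" "\<And>x. x \<notin> (\<Union>y\<in>K. cball y \<delta>) \<Longrightarrow> \<psi> x = 0"
    "\<And>x. \<bar>\<psi> x - w x\<bar> \<le> \<eta>" "\<And>x. norm (gradient \<psi> x - gradient w x) \<le> \<eta>"
proof -
  define \<eta>' where "\<eta>' = \<eta> / real CARD('n)"
  have \<eta>': "\<eta>' > 0" "\<eta>' \<le> \<eta>"
    using pos by (auto simp: \<eta>'_def divide_le_eq)
  have cont: "continuous_on UNIV w" "\<And>i. continuous_on UNIV (partial_deriv i w)"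
    by (rule C1_continuous[OF w], rule C1_partial_continuous[OF w])
  have p0: "partial_deriv i w x = 0" if "x \<notin> K" for i x
    by (rule partial_deriv_eq_0[OF w compact_imp_closed[OF K(1)] K(2) that])
  obtain d1 where d1: "d1 > 0" "\<And>x y. dist y x < d1 \<Longrightarrow> dist (w y) (w x) < \<eta>'"
    using compact_support_uniformly_continuous[OF cont(1) K \<eta>'(1)] by metis
  obtain d2 where d2: "d2 > 0" "\<And>x y. dist y x < d2 \<Longrightarrow> dist (gradient w y) (gradient w x) < \<eta>'"
    using compact_support_uniformly_continuous[OF C1_gradient_continuous[OF w] K(1)
          gradient_eq_0[OF w compact_imp_closed[OF K(1)] K(2)] \<eta>'(1)] by metis
  note d = d1 d2
  define e where "e = min \<delta> (min d1 d2 / 2)"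
  have e: "e > 0" "e \<le> \<delta>" "e < d1" "e < d2" using pos d(1,3) by (auto simp: e_def min_def)
  obtain \<rho> :: "real ^ 'n \<Rightarrow> real" where \<rho>: "\<And>k. C_k k \<rho>" "\<And>x. \<rho> x \<ge> 0" "\<And>x. \<rho> (- x) = \<rho> x"
      "\<And>x. norm x > e \<Longrightarrow> \<rho> x = 0" "(LINT x|lborel. \<rho> x) = 1"
    using mollifier_exists[OF e(1)] by blast
  have c\<rho>: "continuous_on UNIV \<rho>" using \<rho>(1)[of 0] by simp
  show thesis
  proof
    show "C_k k (convolution \<rho> w)" for k
      using K(2) by (rule convolution_C_k[OF \<rho>(1) cont(1) K(1)])
    show "convolution \<rho> w x = 0" if "x \<notin> (\<Union>y\<in>K. cball y \<delta>)" for x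
    proof (rule convolution_eq_0[OF \<rho>(4) _ K(2)])
      show "dist x y > e" if "y \<in> K" for y
        using that \<open>x \<notin> _\<close> e(2) by (auto simp: dist_commute not_le intro: le_less_trans)
    qed
    show "\<bar>convolution \<rho> w x - w x\<bar> \<le> \<eta>" for x
    proof (rule order_trans[OF convolution_approx[OF c\<rho> \<rho>(2-5) cont(1)] \<eta>'(2)])
      show "\<bar>w y - w x\<bar> \<le> \<eta>'" if "dist x y \<le> e" for y
        using d(2)[of y x] e(3) that by (simp add: dist_real_def dist_commute)
    qed
    show "norm (gradient (convolution \<rho> w) x - gradient w x) \<le> \<eta>" for x
    proof -
      have "\<bar>convolution \<rho> (partial_deriv i w) x - partial_deriv i w x\<bar> \<le> \<eta>'" for i
      proof (rule convolution_approx[OF c\<rho> \<rho>(2-5) cont(2)])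
        fix y assume "dist x y \<le> e"
        then have "norm (gradient w y - gradient w x) \<le> \<eta>'"
          using d(4)[of y x] e(4) by (simp add: dist_norm norm_minus_commute)
        then show "\<bar>partial_deriv i w y - partial_deriv i w x\<bar> \<le> \<eta>'"
          using component_le_norm_cart[of "gradient w y - gradient w x" i] by simp
      qed
      moreover have "partial_deriv i (convolution \<rho> w) x = convolution \<rho> (partial_deriv i w) x" for i
        using K(2) by (rule partial_deriv_convolution[OF \<rho>(1) w K(1)])
      ultimately have "\<bar>(gradient (convolution \<rho> w) x - gradient w x) $ i\<bar> \<le> \<eta>'" for i
        by simp
      then have "(\<Sum>i\<in>UNIV. \<bar>(gradient (convolution \<rho> w) x - gradient w x) $ i\<bar>) \<le> real CARD('n) * \<eta>'"
        by (intro sum_bounded_above) auto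
      also have "\<dots> = \<eta>" by (simp add: \<eta>'_def)
      finally show ?thesis
        using norm_le_l1_cart order_trans by blast
    qed
  qed
qed

text \<open>
  The mollifications converge uniformly with their gradients, and all their supports lie in one
  compact neighbourhood of \<open>K\<close> inside \<open>\<Omega>\<close>. So they converge in the norm of $H^1$.
\<close>

lemma H10_gradient_C1:
  fixes w :: "real ^ 'n \<Rightarrow> real"
  assumes \<Omega>: "open \<Omega>" and w: "C1 w" and K: "compact K" "K \<subseteq> \<Omega>" "\<And>x. x \<notin> K \<Longrightarrow> w x = 0"
  shows "H10_gradient \<Omega> w (gradient w)"
proof -
  obtain \<delta> where \<delta>: "\<delta> > 0" "(\<Union>y\<in>K. cball y \<delta>) \<subseteq> \<Omega>"
    using compact_subset_open_imp_cball_epsilon_subset[OF K(1) \<Omega> K(2)] by blast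
  define K' where "K' = (\<Union>y\<in>K. cball y \<delta>)"
  have K': "compact K'" "K' \<subseteq> \<Omega>" "K \<subseteq> K'"
    unfolding K'_def using \<delta> K by (auto intro: compact_minkowski_sum_cball)
  have "\<exists>\<psi>. (\<forall>k. C_k k \<psi>) \<and> (\<forall>x. x \<notin> K' \<longrightarrow> \<psi> x = 0) \<and>
      (\<forall>x. \<bar>\<psi> x - w x\<bar> \<le> 1 / real (Suc m)) \<and> (\<forall>x. norm (gradient \<psi> x - gradient w x) \<le> 1 / real (Suc m))" for m
    by (rule C1_uniform_approximation[OF w K(1,3), where \<eta>="1 / real (Suc m)" and \<delta>=\<delta>])
       (use \<delta> in \<open>auto simp: K'_def\<close>)
  then obtain \<psi> where \<psi>: "\<And>m k. C_k k (\<psi> m)" "\<And>m x. x \<notin> K' \<Longrightarrow> \<psi> m x = 0"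
      "\<And>m x. \<bar>\<psi> m x - w x\<bar> \<le> 1 / real (Suc m)"
      "\<And>m x. norm (gradient (\<psi> m) x - gradient w x) \<le> 1 / real (Suc m)"
    by metis
  let ?F = "\<lambda>m x. (\<psi> m x - w x)\<^sup>2 + (norm (gradient (\<psi> m) x - gradient w x))\<^sup>2"
  let ?M = "measure lborel K'"
  have F0: "?F m x = 0" if "x \<notin> K'" for m x
  proof -
    have "gradient (\<psi> m) x = 0"
      using \<psi>(2) by (rule gradient_eq_0[OF \<psi>(1) compact_imp_closed[OF K'(1)] _ that])
    moreover have "gradient w x = 0"
      by (rule gradient_eq_0[OF w compact_imp_closed[OF K(1)] K(3)]) (use that K' in auto)
    ultimately show ?thesis using \<psi>(2) K(3) K'(3) that by auto
  qed
  have cF: "continuous_on UNIV (?F m)" for m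
    by (intro continuous_intros C1_continuous[OF w] C1_gradient_continuous[OF w]
        C1_continuous[OF \<psi>(1)] C1_gradient_continuous[OF \<psi>(1)])
  have le: "(LINT x|lebesgue_on \<Omega>. ?F m x) \<le> 2 * (1 / real (Suc m))\<^sup>2 * ?M" for m
  proof -
    have "(LINT x|lebesgue_on \<Omega>. ?F m x) = (LINT x|lborel. ?F m x)"
      by (rule integral_lebesgue_on_eq[OF \<Omega> borel_measurable_continuous_onI[OF cF]], rule F0)
         (use K' in auto)
    also have "\<dots> \<le> (LINT x|lborel. 2 * (1 / real (Suc m))\<^sup>2 * indicator K' x)"
    proof (rule integral_mono)
      show "integrable lborel (?F m)"
        by (rule integrable_continuous_compact_support[OF cF K'(1)]) (rule F0)
      show "integrable lborel (\<lambda>x. 2 * (1 / real (Suc m))\<^sup>2 * indicator K' x)"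
        using borel_compact[OF K'(1)] emeasure_bounded_finite[OF compact_imp_bounded[OF K'(1)]]
        by (intro integrable_mult_right integrable_real_indicator) auto
      have "?F m x \<le> (1 / real (Suc m))\<^sup>2 + (1 / real (Suc m))\<^sup>2" for x
        using \<psi>(3,4)[of m x] by (intro add_mono power2_le_iff_abs_le[THEN iffD2] power_mono) auto
      then show "?F m x \<le> 2 * (1 / real (Suc m))\<^sup>2 * indicator K' x" for x
        using F0[of x m] by (cases "x \<in> K'") auto
    qed
    also have "\<dots> = 2 * (1 / real (Suc m))\<^sup>2 * ?M"
      by simp
    finally show ?thesis .
  qed
  have "(\<lambda>m. LINT x|lebesgue_on \<Omega>. ?F m x) \<longlonglongrightarrow> 0"
  proof (rule tendsto_sandwich[OF _ _ tendsto_const])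
    show "(\<lambda>m. 2 * (1 / real (Suc m))\<^sup>2 * ?M) \<longlonglongrightarrow> 0"
    proof -
      have "(\<lambda>m. 2 * (1 / real (Suc m))\<^sup>2 * ?M) \<longlonglongrightarrow> 2 * 0\<^sup>2 * ?M"
        by (intro tendsto_intros LIMSEQ_Suc lim_1_over_n)
      then show ?thesis by simp
    qed
  qed (use le in \<open>auto intro!: always_eventually integral_nonneg_AE\<close>)
  from tendsto_real_sqrt[OF this]
  have "(\<lambda>m. sqrt (LINT x|lebesgue_on \<Omega>. ?F m x)) \<longlonglongrightarrow> 0" by simp
  moreover have "\<psi> m \<in> test_functions \<Omega>" for m
    using \<psi>(2) by (rule test_functionsI[OF \<psi>(1) K'(1,2)])
  ultimately show ?thesis
    unfolding H10_gradient_def using H1_gradient_C1[OF assms] by blast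
qed

section \<open>From test functions to $H^1_0$\<close>

text \<open>
  An open set that misses \<open>\<Sigma>\<close> also misses its closure.
\<close>

lemma infdist_pos_of_open:
  assumes "open \<Omega>" "\<Sigma> \<inter> \<Omega> = {}" "\<Sigma> \<noteq> {}" "x \<in> \<Omega>"
  shows "infdist x \<Sigma> > 0"
proof -
  have "closure \<Sigma> \<inter> \<Omega> = {}"
    using assms open_Int_closure_eq_empty[of \<Omega> \<Sigma>] by (simp add: Int_commute)
  then have "infdist x \<Sigma> \<noteq> 0"
    using assms in_closure_iff_infdist_zero[of \<Sigma> x] by auto
  then show ?thesis using infdist_nonneg[of x \<Sigma>] by simp
qed

text \<open>
  Along a subsequence of the approximating test functions, $\psi_k\to u$ almost everywhere, so
  Fatou's lemma bounds the denominator of \<open>u\<close> by the lower limit of those of $\psi_k$. The numerators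
  converge by convergence of the gradients in $L^2$.
\<close>

lemma hardy_quotient_test_functions_bound:
  fixes u :: "real ^ 'n \<Rightarrow> real"
  assumes \<Omega>: "open \<Omega>" and \<Sigma>: "\<Sigma> \<inter> \<Omega> = {}" "\<Sigma> \<noteq> {}"
    and H: "\<And>\<psi>. \<psi> \<in> test_functions \<Omega> \<Longrightarrow>
      C * (\<integral>\<^sup>+ x. ennreal ((\<psi> x)\<^sup>2 / (infdist x \<Sigma>)\<^sup>2) \<partial>lebesgue_on \<Omega>)
        \<le> (\<integral>\<^sup>+ x. ennreal ((norm (gradient \<psi> x))\<^sup>2) \<partial>lebesgue_on \<Omega>)"
    and u: "H10_gradient \<Omega> u g" and nz: "\<not> (AE x in lebesgue_on \<Omega>. u x = 0)"
  shows "C \<le> hardy_quotient \<Omega> \<Sigma> u g"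
\<comment> \<open>Testing against all \<open>c < C\<close> reduces the claim to finite constants.\<close>
proof (rule dense_le)
  fix c :: ennreal assume "c < C"
  then obtain c' where c': "c = ennreal c'" "c' \<ge> 0"
    by (cases c) auto
  let ?M = "lebesgue_on \<Omega>"
  define A where "A = (LINT x|?M. (norm (g x))\<^sup>2)"
  have um: "u \<in> borel_measurable ?M" "integrable ?M (\<lambda>x. (norm (u x))\<^sup>2)"
    and gm: "g \<in> borel_measurable ?M" "integrable ?M (\<lambda>x. (norm (g x))\<^sup>2)"
    using u by (auto simp: H10_gradient_def H1_gradient_def square_integrable_on_def)
  have A: "(\<integral>\<^sup>+ x. ennreal ((norm (g x))\<^sup>2) \<partial>?M) = ennreal A"
    unfolding A_def using gm(2) by (intro nn_integral_eq_integral) auto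
  have A0: "A \<ge> 0" unfolding A_def by simp
  have dm: "(\<lambda>x. infdist x \<Sigma>) \<in> borel_measurable ?M"
    by (intro borel_measurable_lebesgue_on_borel borel_measurable_continuous_onI continuous_intros)
  obtain \<psi> where \<psi>: "\<And>k. \<psi> k \<in> test_functions \<Omega>"
    and lim: "(\<lambda>k. sqrt (LINT x|?M. (\<psi> k x - u x)\<^sup>2 + (norm (gradient (\<psi> k) x - g x))\<^sup>2)) \<longlonglongrightarrow> 0"
    using u unfolding H10_gradient_def by blast
  define F where "F k x = (\<psi> k x - u x)\<^sup>2 + (norm (gradient (\<psi> k) x - g x))\<^sup>2" for k x
  have \<psi>m: "\<psi> k \<in> borel_measurable ?M" "integrable ?M (\<lambda>x. (norm (\<psi> k x))\<^sup>2)"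
      "gradient (\<psi> k) \<in> borel_measurable ?M" "integrable ?M (\<lambda>x. (norm (gradient (\<psi> k) x))\<^sup>2)" for k
  proof -
    obtain K where K: "C1 (\<psi> k)" "compact K" "K \<subseteq> \<Omega>" "\<And>x. x \<notin> K \<Longrightarrow> \<psi> k x = 0"
      using test_functionsE[OF \<psi>] by metis
    have "H1_gradient \<Omega> (\<psi> k) (gradient (\<psi> k))"
      using K(4) by (rule H1_gradient_C1[OF \<Omega> K(1-3)])
    then show "\<psi> k \<in> borel_measurable ?M" "integrable ?M (\<lambda>x. (norm (\<psi> k x))\<^sup>2)"
      "gradient (\<psi> k) \<in> borel_measurable ?M" "integrable ?M (\<lambda>x. (norm (gradient (\<psi> k) x))\<^sup>2)"
      unfolding H1_gradient_def square_integrable_on_def by blast+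
  qed
  have sq: "(norm (a - b))\<^sup>2 \<le> 2 * (norm a)\<^sup>2 + 2 * (norm b)\<^sup>2" for a b :: "'v::real_inner"
  proof -
    have "0 \<le> (norm (a + b))\<^sup>2" by simp
    then show ?thesis unfolding power2_norm_eq_inner by (simp add: inner_simps inner_commute)
  qed
  have Fm: "F k \<in> borel_measurable ?M" for k
    unfolding F_def using \<psi>m um gm by measurable
  have Fi: "integrable ?M (F k)" for k
  proof (rule Bochner_Integration.integrable_bound[OF _ Fm])
    show "integrable ?M (\<lambda>x. 2 * (norm (\<psi> k x))\<^sup>2 + 2 * (norm (u x))\<^sup>2 + (2 * (norm (gradient (\<psi> k) x))\<^sup>2 + 2 * (norm (g x))\<^sup>2))"
      using \<psi>m um gm by (intro Bochner_Integration.integrable_add integrable_mult_right) auto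
    have "F k x \<le> 2 * (norm (\<psi> k x))\<^sup>2 + 2 * (norm (u x))\<^sup>2 + (2 * (norm (gradient (\<psi> k) x))\<^sup>2 + 2 * (norm (g x))\<^sup>2)" for x
      using add_mono[OF sq[of "\<psi> k x" "u x"] sq[of "gradient (\<psi> k) x" "g x"]] by (simp add: F_def)
    then show "AE x in ?M. norm (F k x) \<le> norm (2 * (norm (\<psi> k x))\<^sup>2 + 2 * (norm (u x))\<^sup>2 + (2 * (norm (gradient (\<psi> k) x))\<^sup>2 + 2 * (norm (g x))\<^sup>2))"
      by (simp add: F_def)
  qed
  define f where "f k = (LINT x|?M. F k x)" for k
  have f0: "f k \<ge> 0" for k unfolding f_def F_def by (intro integral_nonneg_AE) auto
  have "(\<lambda>k. sqrt (f k)) \<longlonglongrightarrow> 0"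
    using lim by (simp add: f_def F_def)
  then have "(\<lambda>k. (sqrt (f k))\<^sup>2) \<longlonglongrightarrow> 0\<^sup>2" by (rule tendsto_power)
  then have flim: "f \<longlonglongrightarrow> 0" using f0 by simp
  moreover have "norm (F k x) = F k x" for k x by (simp add: F_def)
  ultimately have "(\<lambda>k. LINT x|?M. norm (F k x)) \<longlonglongrightarrow> 0"
    by (simp add: f_def[abs_def])
  then obtain r where r: "strict_mono (r :: nat \<Rightarrow> nat)" "AE x in ?M. (\<lambda>k. F (r k) x) \<longlonglongrightarrow> 0"
    using tendsto_L1_AE_subseq[of ?M F, OF Fi] by blast
  have AE\<psi>: "AE x in ?M. (\<lambda>k. \<psi> (r k) x) \<longlonglongrightarrow> u x"
    using r(2)
  proof eventually_elim
    case (elim x)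
    have "(\<lambda>k. \<bar>\<psi> (r k) x - u x\<bar>) \<longlonglongrightarrow> 0"
    proof (rule tendsto_sandwich[OF _ _ tendsto_const])
      show "(\<lambda>k. sqrt (F (r k) x)) \<longlonglongrightarrow> 0"
        using tendsto_real_sqrt[OF elim] by simp
      have "\<bar>\<psi> (r k) x - u x\<bar> \<le> sqrt (F (r k) x)" for k
        by (rule real_le_rsqrt) (simp add: F_def)
      then show "\<forall>\<^sub>F k in sequentially. \<bar>\<psi> (r k) x - u x\<bar> \<le> sqrt (F (r k) x)" by simp
    qed simp
    then show ?case using LIM_zero_cancel tendsto_rabs_zero_iff by blast
  qed
  define B where "B = (\<integral>\<^sup>+ x. ennreal ((u x)\<^sup>2 / (infdist x \<Sigma>)\<^sup>2) \<partial>?M)"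
  have hm: "(\<lambda>x. (v x)\<^sup>2 / (infdist x \<Sigma>)\<^sup>2) \<in> borel_measurable ?M" if "v \<in> borel_measurable ?M" for v
    by (intro borel_measurable_divide borel_measurable_power dm that)
  have em: "(\<lambda>x. ennreal ((v x)\<^sup>2 / (infdist x \<Sigma>)\<^sup>2)) \<in> borel_measurable ?M" if "v \<in> borel_measurable ?M" for v
    by (rule measurable_compose[OF hm[OF that] measurable_ennreal])
  let ?q = "\<lambda>v x. ennreal c' * ennreal ((v x)\<^sup>2 / (infdist x \<Sigma>)\<^sup>2)"
  have qm: "?q v \<in> borel_measurable ?M" if "v \<in> borel_measurable ?M" for v
    by (intro borel_measurable_times_ennreal borel_measurable_const em that)
  have "c * B = (\<integral>\<^sup>+ x. ?q u x \<partial>?M)"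
    unfolding B_def c'(1) by (intro nn_integral_cmult[symmetric] em um)
  also have "\<dots> = (\<integral>\<^sup>+ x. liminf (\<lambda>k. ?q (\<psi> (r k)) x) \<partial>?M)"
  proof (rule nn_integral_cong_AE, use AE\<psi> in eventually_elim)
    case (elim x)
    have "(\<lambda>k. c' * ((\<psi> (r k) x)\<^sup>2 * (1 / (infdist x \<Sigma>)\<^sup>2))) \<longlonglongrightarrow> c' * ((u x)\<^sup>2 * (1 / (infdist x \<Sigma>)\<^sup>2))"
      by (intro tendsto_intros elim)
    then have "(\<lambda>k. ?q (\<psi> (r k)) x) \<longlonglongrightarrow> ?q u x"
      using c'(2) by (simp add: ennreal_mult[symmetric] tendsto_ennrealI)
    then show ?case using lim_imp_Liminf[OF sequentially_bot] by metis
  qed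
  also have "\<dots> \<le> liminf (\<lambda>k. \<integral>\<^sup>+ x. ?q (\<psi> (r k)) x \<partial>?M)"
    by (rule nn_integral_liminf) (rule qm[OF \<psi>m(1)])
  finally have fatou: "c * B \<le> liminf (\<lambda>k. \<integral>\<^sup>+ x. ?q (\<psi> (r k)) x \<partial>?M)" .
  have bound: "(\<integral>\<^sup>+ x. ?q (\<psi> k) x \<partial>?M) \<le> ennreal ((1 + \<eta>) * A + (1 + 1 / \<eta>) * f k)" if "\<eta> > 0" for k \<eta>
  proof -
    have "(\<integral>\<^sup>+ x. ?q (\<psi> k) x \<partial>?M) = c * (\<integral>\<^sup>+ x. ennreal ((\<psi> k x)\<^sup>2 / (infdist x \<Sigma>)\<^sup>2) \<partial>?M)"
      unfolding c'(1) by (intro nn_integral_cmult em \<psi>m)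
    also have "\<dots> \<le> C * (\<integral>\<^sup>+ x. ennreal ((\<psi> k x)\<^sup>2 / (infdist x \<Sigma>)\<^sup>2) \<partial>?M)"
      using \<open>c < C\<close> by (intro mult_right_mono) auto
    also have "\<dots> \<le> (\<integral>\<^sup>+ x. ennreal ((norm (gradient (\<psi> k) x))\<^sup>2) \<partial>?M)"
      by (rule H[OF \<psi>])
    also have "\<dots> \<le> (\<integral>\<^sup>+ x. ennreal ((1 + \<eta>) * (norm (g x))\<^sup>2 + (1 + 1 / \<eta>) * F k x) \<partial>?M)"
    proof (intro nn_integral_mono ennreal_leI)
      fix x
      let ?a = "gradient (\<psi> k) x" and ?b = "g x"
      \<comment> \<open>$|a|^2\le(1+\eta)|b|^2+(1+1/\eta)|a-b|^2$, by expanding a square.\<close>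
      have "0 \<le> (norm (\<eta> *\<^sub>R ?b - (?a - ?b)))\<^sup>2 / \<eta>" using that by simp
      also have "\<dots> = (1 + \<eta>) * (norm ?b)\<^sup>2 + (1 + 1 / \<eta>) * (norm (?a - ?b))\<^sup>2 - (norm ?a)\<^sup>2"
        using that unfolding power2_norm_eq_inner
        by (simp add: inner_simps inner_commute field_simps power2_eq_square)
      finally have "(norm ?a)\<^sup>2 \<le> (1 + \<eta>) * (norm ?b)\<^sup>2 + (1 + 1 / \<eta>) * (norm (?a - ?b))\<^sup>2" by simp
      also have "\<dots> \<le> (1 + \<eta>) * (norm ?b)\<^sup>2 + (1 + 1 / \<eta>) * F k x"
        using that by (intro add_mono mult_left_mono) (auto simp: F_def)
      finally show "(norm ?a)\<^sup>2 \<le> (1 + \<eta>) * (norm ?b)\<^sup>2 + (1 + 1 / \<eta>) * F k x" .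
    qed
    also have "\<dots> = ennreal (LINT x|?M. (1 + \<eta>) * (norm (g x))\<^sup>2 + (1 + 1 / \<eta>) * F k x)"
    proof (rule nn_integral_eq_integral)
      show "integrable ?M (\<lambda>x. (1 + \<eta>) * (norm (g x))\<^sup>2 + (1 + 1 / \<eta>) * F k x)"
        by (intro Bochner_Integration.integrable_add integrable_mult_right gm(2) Fi)
      show "AE x in ?M. 0 \<le> (1 + \<eta>) * (norm (g x))\<^sup>2 + (1 + 1 / \<eta>) * F k x"
        using that by (simp add: F_def)
    qed
    also have "(LINT x|?M. (1 + \<eta>) * (norm (g x))\<^sup>2 + (1 + 1 / \<eta>) * F k x) = (1 + \<eta>) * A + (1 + 1 / \<eta>) * f k"
      using gm(2) Fi by (simp add: A_def f_def)
    finally show ?thesis .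
  qed
  have "c * B \<le> ennreal ((1 + \<eta>) * A)" if "\<eta> > 0" for \<eta>
  proof -
    have "(\<lambda>k. (1 + \<eta>) * A + (1 + 1 / \<eta>) * f (r k)) \<longlonglongrightarrow> (1 + \<eta>) * A + (1 + 1 / \<eta>) * 0"
      using LIMSEQ_subseq_LIMSEQ[OF flim r(1)] by (intro tendsto_intros) (simp add: o_def)
    then have "(\<lambda>k. ennreal ((1 + \<eta>) * A + (1 + 1 / \<eta>) * f (r k))) \<longlonglongrightarrow> ennreal ((1 + \<eta>) * A)"
      by (intro tendsto_ennrealI) simp
    then have eq: "liminf (\<lambda>k. ennreal ((1 + \<eta>) * A + (1 + 1 / \<eta>) * f (r k))) = ennreal ((1 + \<eta>) * A)"
      by (rule lim_imp_Liminf[OF sequentially_bot])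
    have "liminf (\<lambda>k. \<integral>\<^sup>+ x. ?q (\<psi> (r k)) x \<partial>?M) \<le> liminf (\<lambda>k. ennreal ((1 + \<eta>) * A + (1 + 1 / \<eta>) * f (r k)))"
      by (intro Liminf_mono always_eventually allI bound[OF that])
    from order_trans[OF fatou this] show ?thesis unfolding eq .
  qed
  then have ev: "\<forall>\<^sub>F \<eta> in at_right 0. c * B \<le> ennreal ((1 + \<eta>) * A)"
    by (simp add: eventually_at_filter)
  have "((\<lambda>\<eta>. ennreal ((1 + \<eta>) * A)) \<longlongrightarrow> ennreal ((1 + 0) * A)) (at_right 0)"
    by (intro tendsto_ennrealI tendsto_intros)
  from tendsto_lowerbound[OF this ev]
  have cB: "c * B \<le> ennreal A" by simp
  have "B \<noteq> 0"
  proof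
    assume "B = 0"
    then have "AE x in ?M. ennreal ((u x)\<^sup>2 / (infdist x \<Sigma>)\<^sup>2) = 0"
      unfolding B_def by (subst (asm) nn_integral_0_iff_AE[OF em[OF um(1)]])
    then have "AE x in ?M. u x = 0"
      using AE_space
    proof eventually_elim
      case (elim x)
      then have "x \<in> \<Omega>" by (simp add: space_restrict_space)
      with infdist_pos_of_open[OF \<Omega> \<Sigma>, of x] elim show ?case
        by (auto simp: ennreal_eq_0_iff divide_le_0_iff)
    qed
    with nz show False by simp
  qed
  have "c \<le> ennreal A / B"
  proof (cases "B = top")
    case True
    then have "c = 0" using cB by (cases "c = 0") (auto simp: ennreal_mult_top top_unique)
    then show ?thesis by simp
  next
    case False
    then have "c = c * B / B" using \<open>B \<noteq> 0\<close> by (simp add: ennreal_mult_divide_eq)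
    also have "\<dots> \<le> ennreal A / B" by (rule divide_right_mono_ennreal[OF cB])
    finally show ?thesis .
  qed
  then show "c \<le> hardy_quotient \<Omega> \<Sigma> u g"
    by (simp add: hardy_quotient_def A B_def)
qed

lemma nn_integral_lebesgue_on_eq:
  fixes f :: "'a::euclidean_space \<Rightarrow> ennreal"
  assumes "open S" "f \<in> borel_measurable borel"
  shows "(\<integral>\<^sup>+ x. f x \<partial>lebesgue_on S) = (\<integral>\<^sup>+ x. f x * indicator S x \<partial>lborel)"
  using assms by (simp add: nn_integral_restrict_space nn_integral_completion)

text \<open>
  The Hardy constant before conversion to a real number. In the extended reals
  the multiplicative comparison below also covers an infinite infimum.
\<close>

definition hardy_infimum :: "(real ^ 'n) set \<Rightarrow> (real ^ 'n) set \<Rightarrow> ennreal" where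
  "hardy_infimum \<Omega> \<Sigma> = Inf {hardy_quotient \<Omega> \<Sigma> u g | u g.
     H10_gradient \<Omega> u g \<and> \<not> (AE x in lebesgue_on \<Omega>. u x = 0)}"

lemma ennreal_le_divide_imp_mult_le:
  assumes "c \<le> a / (b::ennreal)"
  shows "c * b \<le> a"
proof (cases "b = 0 \<or> b = top")
  case True
  with assms show ?thesis by auto
next
  case False
  have "c * b \<le> a / b * b" using assms by (intro mult_right_mono) auto
  also have "\<dots> = a"
    using False by (simp add: ennreal_divide_times ennreal_divide_self less_top)
  finally show ?thesis .
qed

lemma hardy_inequality_C1:
  fixes w :: "real ^ 'n \<Rightarrow> real"
  assumes \<Omega>: "open \<Omega>" and w: "C1 w" and K: "compact K" "K \<subseteq> \<Omega>" "\<And>x. x \<notin> K \<Longrightarrow> w x = 0"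
  shows "hardy_infimum \<Omega> \<Sigma> * (\<integral>\<^sup>+ x. ennreal ((w x)\<^sup>2 / (infdist x \<Sigma>)\<^sup>2) \<partial>lebesgue_on \<Omega>)
     \<le> (\<integral>\<^sup>+ x. ennreal ((norm (gradient w x))\<^sup>2) \<partial>lebesgue_on \<Omega>)"
proof (cases "AE x in lebesgue_on \<Omega>. w x = 0")
  case True
  then have "AE x in lebesgue_on \<Omega>. ennreal ((w x)\<^sup>2 / (infdist x \<Sigma>)\<^sup>2) = 0"
    by (auto elim: eventually_mono)
  then have "(\<integral>\<^sup>+ x. ennreal ((w x)\<^sup>2 / (infdist x \<Sigma>)\<^sup>2) \<partial>lebesgue_on \<Omega>) = 0"
    by (subst nn_integral_cong_AE[where v="\<lambda>_. 0"]) auto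
  then show ?thesis by simp
next
  case False
  have "H10_gradient \<Omega> w (gradient w)"
    using K(3) by (rule H10_gradient_C1[OF \<Omega> w K(1,2)])
  then have "hardy_infimum \<Omega> \<Sigma> \<le> hardy_quotient \<Omega> \<Sigma> w (gradient w)"
    unfolding hardy_infimum_def using False by (intro Inf_lower) blast
  then show ?thesis
    unfolding hardy_quotient_def by (rule ennreal_le_divide_imp_mult_le)
qed

section \<open>Maps close to the identity\<close>

text \<open>
  The map \<open>T\<close> minus the identity is Lipschitz on \<open>U\<close> with constant \<open>\<eta>\<close>. In contrast to a bound on
  $DT-I$ this passes to closures and to inverse maps.
\<close>

definition near_identity :: "real \<Rightarrow> ('a::real_normed_vector \<Rightarrow> 'a) \<Rightarrow> 'a set \<Rightarrow> bool" where
  "near_identity \<eta> T U \<longleftrightarrow> (\<forall>x\<in>U. \<forall>y\<in>U. norm (T x - T y - (x - y)) \<le> \<eta> * norm (x - y))"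

text \<open>
  The factor by which the volume of a cube in dimension \<open>n\<close> grows when its sides are
  stretched by the factor $1+n\eta$.
\<close>

definition distortion :: "nat \<Rightarrow> real \<Rightarrow> real" where
  "distortion n \<eta> = (1 + real n * \<eta>) ^ n"

lemma near_identity_closure:
  fixes T :: "'a::euclidean_space \<Rightarrow> 'a"
  assumes near: "near_identity \<eta> T U" and cont: "continuous_on UNIV T"
  shows "near_identity \<eta> T (closure U)"
proof -
  let ?S = "{z. norm (T (fst z) - T (snd z) - (fst z - snd z)) \<le> \<eta> * norm (fst z - snd z)}"
  have "closed ?S"
    by (intro closed_Collect_le continuous_intros continuous_on_compose2[OF cont]) auto
  moreover have "U \<times> U \<subseteq> ?S" using near by (auto simp: near_identity_def)
  ultimately have "closure (U \<times> U) \<subseteq> ?S" by (rule closure_minimal[rotated])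
  then show ?thesis by (force simp: near_identity_def closure_Times)
qed

text \<open>
  With $a=T(x)$ and $b=T(y)$ the defining inequality is symmetric up to replacing $|x-y|$ by $|a-b|$,
  and $\delta\le1/2$ gives $|x-y|\le2|a-b|$.
\<close>

lemma near_identity_inverse:
  assumes near: "near_identity \<delta> T U" and P: "\<And>x. P (T x) = x" and \<delta>: "\<delta> \<le> 1 / 2"
  shows "near_identity (2 * \<delta>) P (T ` U)"
  unfolding near_identity_def
proof (intro ballI)
  fix a b assume "a \<in> T ` U" "b \<in> T ` U"
  then obtain x y where xy: "x \<in> U" "y \<in> U" "a = T x" "b = T y" by blast
  have *: "norm (a - b - (x - y)) \<le> \<delta> * norm (x - y)"
    using near xy by (auto simp: near_identity_def)
  have "norm (x - y) \<le> norm (a - b) + norm (a - b - (x - y))"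
    using norm_triangle_ineq4[of "a - b" "a - b - (x - y)"] by simp
  also have "\<dots> \<le> norm (a - b) + norm (x - y) / 2"
    using * mult_right_mono[OF \<delta> norm_ge_zero[of "x - y"]] by simp
  finally have 2: "norm (x - y) \<le> 2 * norm (a - b)" by simp
  have "norm (x - y - (a - b)) \<le> \<delta> * norm (x - y)"
    using * by (simp add: norm_minus_commute)
  also have "\<dots> \<le> 2 * \<delta> * norm (a - b)"
  proof (cases "\<delta> \<ge> 0")
    case True
    then show ?thesis using mult_left_mono[OF 2 True] by simp
  next
    case False
    then have "norm (x - y) = 0"
      using order_trans[OF norm_ge_zero *] by (simp add: zero_le_mult_iff)
    then have "a = b" using xy by simp
    then show ?thesis using \<open>norm (x - y) = 0\<close> by simp
  qed
  finally show "norm (P a - P b - (a - b)) \<le> 2 * \<delta> * norm (a - b)"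
    using xy P by simp
qed

lemma near_identity_Lipschitz:
  assumes "near_identity \<eta> T U" "x \<in> U" "y \<in> U"
  shows "norm (T x - T y) \<le> (1 + \<eta>) * norm (x - y)"
proof -
  have "norm (T x - T y) \<le> norm (x - y) + norm (T x - T y - (x - y))"
    using norm_triangle_sub[of "T x - T y" "x - y"] by simp
  then show ?thesis
    using assms by (fastforce simp: near_identity_def algebra_simps)
qed

lemma has_derivative_Lipschitz_bound:
  fixes f :: "'a::real_normed_vector \<Rightarrow> 'b::real_normed_vector"
  assumes f: "(f has_derivative f') (at y)" and U: "open U" "y \<in> U"
    and B: "\<And>z. z \<in> U \<Longrightarrow> norm (f z - f y) \<le> B * norm (z - y)"
  shows "norm (f' h) \<le> B * norm h"
proof -
  have "((\<lambda>t. y + t *\<^sub>R h) has_derivative (\<lambda>t. t *\<^sub>R h)) (at 0)"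
    by (auto intro!: derivative_eq_intros)
  moreover have "(f has_derivative f') (at (y + 0 *\<^sub>R h))" using f by simp
  ultimately have "((\<lambda>t. f (y + t *\<^sub>R h)) has_derivative (\<lambda>t. f' (t *\<^sub>R h))) (at 0)"
    by (rule has_derivative_compose)
  moreover have "f' (t *\<^sub>R h) = t *\<^sub>R f' h" for t
    using has_derivative_linear[OF f] by (rule linear_cmul)
  ultimately have "((\<lambda>t. f (y + t *\<^sub>R h)) has_derivative (\<lambda>t. t *\<^sub>R f' h)) (at 0)"
    by simp
  then have lim: "(\<lambda>t. norm (f (y + t *\<^sub>R h) - f y - t *\<^sub>R f' h) / norm t) \<midarrow>0\<rightarrow> 0"
    by (simp add: has_derivative_at)
  have "((\<lambda>t. y + t *\<^sub>R h) \<longlongrightarrow> y + 0 *\<^sub>R h) (at 0)" by (intro tendsto_intros)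
  then have "eventually (\<lambda>t. y + t *\<^sub>R h \<in> U) (at 0)"
    using U by (auto dest: topological_tendstoD)
  then have "eventually (\<lambda>t. norm (f' h) \<le> B * norm h + norm (f (y + t *\<^sub>R h) - f y - t *\<^sub>R f' h) / norm t) (at 0)"
    using eventually_neq_at_within[of 0 0 UNIV]
  proof eventually_elim
    case (elim t)
    have "\<bar>t\<bar> * norm (f' h) = norm (t *\<^sub>R f' h)" by simp
    also have "\<dots> \<le> norm (f (y + t *\<^sub>R h) - f y) + norm (f (y + t *\<^sub>R h) - f y - t *\<^sub>R f' h)"
      using norm_triangle_ineq4[of "f (y + t *\<^sub>R h) - f y" "f (y + t *\<^sub>R h) - f y - t *\<^sub>R f' h"] by simp
    also have "norm (f (y + t *\<^sub>R h) - f y) \<le> B * (\<bar>t\<bar> * norm h)"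
      using B[OF elim(1)] by simp
    finally show ?case using elim(2) by (simp add: field_simps)
  qed
  from tendsto_lowerbound[OF tendsto_add[OF tendsto_const lim] this]
  show ?thesis by simp
qed

lemma infdist_image_le:
  fixes T :: "'a::real_normed_vector \<Rightarrow> 'a"
  assumes T: "near_identity \<eta> T U" "\<eta> \<ge> 0" and \<Sigma>: "\<Sigma> \<subseteq> U" "\<Sigma> \<noteq> {}" and x: "x \<in> U"
  shows "infdist (T x) (T ` \<Sigma>) \<le> (1 + \<eta>) * infdist x \<Sigma>"
proof -
  have "infdist (T x) (T ` \<Sigma>) / (1 + \<eta>) \<le> (INF y\<in>\<Sigma>. dist x y)"
  proof (rule cINF_greatest[OF \<Sigma>(2)])
    fix y assume y: "y \<in> \<Sigma>"
    have "infdist (T x) (T ` \<Sigma>) \<le> dist (T x) (T y)" using y by (intro infdist_le) auto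
    also have "\<dots> \<le> (1 + \<eta>) * dist x y"
      unfolding dist_norm using \<Sigma>(1) y x by (intro near_identity_Lipschitz[OF T(1)]) auto
    finally show "infdist (T x) (T ` \<Sigma>) / (1 + \<eta>) \<le> dist x y"
      using T(2) by (simp add: divide_le_eq mult.commute)
  qed
  then show ?thesis using \<Sigma>(2) T(2) by (simp add: infdist_notempty divide_le_eq mult.commute)
qed

text \<open>
  The mean value inequality for \<open>\<phi>\<close> minus the identity.
\<close>

lemma near_identity_of_jacobian:
  fixes \<phi> :: "real ^ 'n \<Rightarrow> real ^ 'n"
  assumes \<phi>: "C1_map \<phi>" and \<delta>: "\<And>x. x \<in> S \<Longrightarrow> onorm ((*v) (jacobian \<phi> (at x) - mat 1)) \<le> \<delta>"
    and S: "convex S"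
  shows "near_identity \<delta> \<phi> S"
  unfolding near_identity_def
proof (intro ballI)
  fix x y assume xy: "x \<in> S" "y \<in> S"
  have d: "((\<lambda>x. \<phi> x - x) has_derivative (*v) (jacobian \<phi> (at x) - mat 1)) (at x within S)" for x
  proof -
    have "(\<phi> has_derivative (\<lambda>h. jacobian \<phi> (at x) *v h)) (at x)"
      using \<phi> by (simp add: C1_map_def differentiable_on_def flip: jacobian_works)
    then have "((\<lambda>x. \<phi> x - x) has_derivative (\<lambda>h. jacobian \<phi> (at x) *v h - h)) (at x)"
      by (intro has_derivative_diff has_derivative_ident)
    then show ?thesis
      by (rule has_derivative_at_withinI[OF has_derivative_eq_rhs]) (simp add: fun_eq_iff matrix_vector_mult_diff_rdistrib)
  qed
  have "norm ((\<phi> x - x) - (\<phi> y - y)) \<le> \<delta> * norm (x - y)"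
    by (rule differentiable_bound[OF S d \<delta> xy])
  then show "norm (\<phi> x - \<phi> y - (x - y)) \<le> \<delta> * norm (x - y)"
    by (simp add: algebra_simps)
qed

section \<open>Volume distortion of maps close to the identity\<close>

text \<open>
  The displacement \<open>T x - x\<close> varies by at most $\eta n s/2$ between the centre and the
  points of a cube of side $s$, so the image lies in a cube of side $(1+n\eta)s$. Volume is
  measured on the interior because adjacent cubes of a decomposition share faces.
\<close>

lemma near_identity_cube:
  fixes T :: "'a::euclidean_space \<Rightarrow> 'a"
  assumes T: "near_identity \<eta> T U" "\<eta> \<ge> 0" and Q: "cbox u v \<subseteq> U"
    and s: "s \<ge> 0" "\<And>i. i \<in> Basis \<Longrightarrow> v \<bullet> i - u \<bullet> i = s"
  shows "\<exists>w z. T ` cbox u v \<subseteq> cbox w z \<and>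
    emeasure lborel (cbox w z) \<le> ennreal (distortion DIM('a) \<eta>) * emeasure lborel (interior (cbox u v))"
proof -
  define c where "c = u + (s / 2) *\<^sub>R (One :: 'a)"
  define r where "r = (1 + real DIM('a) * \<eta>) * (s / 2)"
  have r: "r \<ge> 0" using s T(2) by (simp add: r_def)
  have ci: "c \<bullet> i = u \<bullet> i + s / 2" if "i \<in> Basis" for i
    using that by (simp add: c_def inner_simps)
  have cQ: "c \<in> cbox u v"
    unfolding mem_box
  proof
    fix i :: 'a assume "i \<in> Basis"
    with s(2)[of i] ci[of i] s(1) show "u \<bullet> i \<le> c \<bullet> i \<and> c \<bullet> i \<le> v \<bullet> i" by simp
  qed
  have "T x \<in> cbox (T c - r *\<^sub>R One) (T c + r *\<^sub>R One)" if x: "x \<in> cbox u v" for x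
  proof -
    have xi: "\<bar>(x - c) \<bullet> i\<bar> \<le> s / 2" if "i \<in> Basis" for i
    proof -
      have "u \<bullet> i \<le> x \<bullet> i" "x \<bullet> i \<le> v \<bullet> i" using x that by (auto simp: mem_box)
      then show ?thesis
        unfolding inner_diff_left abs_le_iff using ci[OF that] s(2)[OF that] by linarith
    qed
    have "norm (x - c) \<le> (\<Sum>i\<in>Basis. \<bar>(x - c) \<bullet> i\<bar>)" by (rule norm_le_l1)
    also have "\<dots> \<le> real DIM('a) * (s / 2)" using xi by (intro sum_bounded_above)
    finally have "\<eta> * norm (x - c) \<le> \<eta> * (real DIM('a) * (s / 2))"
      using T(2) by (intro mult_left_mono)
    moreover have "norm (T x - T c - (x - c)) \<le> \<eta> * norm (x - c)"
      using T(1) Q x cQ unfolding near_identity_def by blast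
    ultimately have d: "norm (T x - T c - (x - c)) \<le> \<eta> * (real DIM('a) * (s / 2))" by simp
    have "\<bar>(T x - T c) \<bullet> i\<bar> \<le> r" if i: "i \<in> Basis" for i
    proof -
      have "\<bar>(T x - T c - (x - c)) \<bullet> i\<bar> \<le> \<eta> * (real DIM('a) * (s / 2))"
        using Basis_le_norm[OF i, of "T x - T c - (x - c)"] d by simp
      moreover have "(T x - T c) \<bullet> i = (T x - T c - (x - c)) \<bullet> i + (x - c) \<bullet> i"
        by (simp add: inner_simps)
      moreover have "r = \<eta> * (real DIM('a) * (s / 2)) + s / 2"
        by (simp add: r_def algebra_simps)
      ultimately show ?thesis using xi[OF i] by linarith
    qed
    then have "\<bar>T x \<bullet> i - T c \<bullet> i\<bar> \<le> r" if "i \<in> Basis" for i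
      using that by (simp add: inner_diff_left)
    then show ?thesis unfolding mem_box by (auto simp: inner_simps abs_le_iff algebra_simps)
  qed
  moreover have "emeasure lborel (cbox (T c - r *\<^sub>R One) (T c + r *\<^sub>R One)) = ennreal ((2 * r) ^ DIM('a))"
    using r by (subst emeasure_lborel_cbox) (auto simp: inner_simps algebra_simps)
  moreover have "emeasure lborel (interior (cbox u v)) = ennreal (s ^ DIM('a))"
  proof -
    have "u \<bullet> i \<le> v \<bullet> i" if "i \<in> Basis" for i using s(1) s(2)[OF that] by linarith
    then show ?thesis using s(2) by (simp add: inner_diff_left)
  qed
  moreover have "(2 * r) ^ DIM('a) = distortion DIM('a) \<eta> * s ^ DIM('a)"
    by (simp add: r_def distortion_def power_mult_distrib[symmetric])
  moreover have "distortion DIM('a) \<eta> \<ge> 0" using T(2) by (simp add: distortion_def)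
  ultimately show ?thesis using s(1)
    by (intro exI[of _ "T c - r *\<^sub>R One"] exI[of _ "T c + r *\<^sub>R One"]) (auto simp: ennreal_mult)
qed

text \<open>
  An open set is a countable union of cubes with disjoint interiors.
\<close>

lemma near_identity_emeasure_bounded:
  fixes T :: "'a::euclidean_space \<Rightarrow> 'a"
  assumes T: "near_identity \<eta> T U" "\<eta> \<ge> 0" and V: "open V" "bounded V" "V \<subseteq> U"
  shows "emeasure lborel (T ` V) \<le> ennreal (distortion DIM('a) \<eta>) * emeasure lborel V"
proof (cases "V = {}")
  case False
  let ?L = "ennreal (distortion DIM('a) \<eta>)"
  obtain R where R: "R > 0" "\<And>x. x \<in> V \<Longrightarrow> norm x \<le> R"
    using V(2) unfolding bounded_pos by blast
  let ?a = "- (R *\<^sub>R One) :: 'a" and ?b = "R *\<^sub>R One :: 'a"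
  have sub: "V \<subseteq> cbox ?a ?b"
  proof
    fix x assume "x \<in> V"
    then have "\<bar>x \<bullet> i\<bar> \<le> R" if "i \<in> Basis" for i
      using R(2) Basis_le_norm[OF that, of x] by force
    then show "x \<in> cbox ?a ?b" by (auto simp: mem_box abs_le_iff minus_le_iff)
  qed
  have ne: "box ?a ?b \<noteq> {}" using R(1) by (auto simp: box_ne_empty)
  \<comment> \<open>This gauge forces every cube of the covering lemma into \<open>V\<close>.\<close>
  have gauge: "gauge (\<lambda>x. if x \<in> V then V else UNIV)" using V(1) by (auto simp: gauge_def)
  obtain \<D> where \<D>: "countable \<D>" "\<And>K. K \<in> \<D> \<Longrightarrow> interior K \<noteq> {} \<and> (\<exists>c d. K = cbox c d)"
    "pairwise (\<lambda>A B. interior A \<inter> interior B = {}) \<D>"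
    "\<And>K. K \<in> \<D> \<Longrightarrow> \<exists>x \<in> V \<inter> K. K \<subseteq> (if x \<in> V then V else UNIV)"
    "\<And>u v. cbox u v \<in> \<D> \<Longrightarrow> \<exists>n. \<forall>i \<in> Basis. v \<bullet> i - u \<bullet> i = (?b \<bullet> i - ?a \<bullet> i) / 2^n"
    "V \<subseteq> \<Union>\<D>"
    using covering_lemma[OF sub ne gauge] by metis
  have DV: "K \<subseteq> V" if "K \<in> \<D>" for K using \<D>(4)[OF that] by auto
  have "\<exists>w z. T ` K \<subseteq> cbox w z \<and> emeasure lborel (cbox w z) \<le> ?L * emeasure lborel (interior K)"
    if K: "K \<in> \<D>" for K
  proof -
    obtain u v where uv: "K = cbox u v" using \<D>(2)[OF K] by blast
    then obtain m where "\<forall>i \<in> Basis. v \<bullet> i - u \<bullet> i = (?b \<bullet> i - ?a \<bullet> i) / 2^m"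
      using \<D>(5)[of u v] K by blast
    then have "v \<bullet> i - u \<bullet> i = 2 * R / 2 ^ m" if "i \<in> Basis" for i
      using that by simp
    then show ?thesis
      using DV[OF K] V(3) R(1) unfolding uv by (intro near_identity_cube[OF T, where s="2 * R / 2 ^ m"]) auto
  qed
  then obtain w z where wz: "\<And>K. K \<in> \<D> \<Longrightarrow> T ` K \<subseteq> cbox (w K) (z K)"
    "\<And>K. K \<in> \<D> \<Longrightarrow> emeasure lborel (cbox (w K) (z K)) \<le> ?L * emeasure lborel (interior K)"
    by metis
  \<comment> \<open>Cubes are numbered injectively, with empty sets at unused numbers, to sum over all naturals.\<close>
  define I where "I = to_nat_on \<D> ` \<D>"
  define f where "f k = (if k \<in> I then interior (from_nat_into \<D> k) else {})" for k
  define g where "g k = (if k \<in> I then cbox (w (from_nat_into \<D> k)) (z (from_nat_into \<D> k)) else {})" for k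
  have from_to: "from_nat_into \<D> (to_nat_on \<D> K) = K" if "K \<in> \<D>" for K
    using \<D>(1) that by simp
  have gf: "emeasure lborel (g k) \<le> ?L * emeasure lborel (f k)" for k
    using wz(2) from_to by (auto simp: g_def f_def I_def)
  have "T ` V \<subseteq> (\<Union>k. g k)"
  proof
    fix y assume "y \<in> T ` V"
    then obtain x K where x: "y = T x" "x \<in> K" "K \<in> \<D>" using \<D>(6) by blast
    then have "y \<in> g (to_nat_on \<D> K)"
      using wz(1) from_to by (auto simp: g_def I_def)
    then show "y \<in> (\<Union>k. g k)" by blast
  qed
  then have "emeasure lborel (T ` V) \<le> emeasure lborel (\<Union>k. g k)"
    by (intro emeasure_mono) (auto simp: g_def)
  also have "\<dots> \<le> (\<Sum>k. emeasure lborel (g k))"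
    by (rule emeasure_subadditive_countably) (auto simp: g_def)
  also have "\<dots> \<le> (\<Sum>k. ?L * emeasure lborel (f k))"
    using gf by (intro suminf_le) auto
  also have "\<dots> = ?L * (\<Sum>k. emeasure lborel (f k))"
    by (rule ennreal_suminf_cmult)
  also have "(\<Sum>k. emeasure lborel (f k)) = emeasure lborel (\<Union>k. f k)"
  proof (rule suminf_emeasure)
    show "disjoint_family f"
      unfolding disjoint_family_on_def
    proof (intro ballI impI)
      fix k l :: nat assume "k \<noteq> l"
      show "f k \<inter> f l = {}"
      proof (cases "k \<in> I \<and> l \<in> I")
        case True
        then obtain K M where KM: "K \<in> \<D>" "M \<in> \<D>" "k = to_nat_on \<D> K" "l = to_nat_on \<D> M"
          by (auto simp: I_def)
        then have "K \<noteq> M" using \<open>k \<noteq> l\<close> by auto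
        then show ?thesis
          using \<D>(3) KM True from_to by (auto simp: f_def pairwise_def)
      qed (auto simp: f_def)
    qed
  qed (auto simp: f_def)
  also have "\<dots> \<le> emeasure lborel V"
  proof (rule emeasure_mono)
    show "(\<Union>k. f k) \<subseteq> V"
    proof (clarify)
      fix x k assume x: "x \<in> f k"
      then have "k \<in> I" by (auto simp: f_def split: if_splits)
      then obtain K where K: "K \<in> \<D>" "k = to_nat_on \<D> K" by (auto simp: I_def)
      then have "x \<in> K" using x \<open>k \<in> I\<close> from_to interior_subset by (auto simp: f_def)
      then show "x \<in> V" using DV[OF K(1)] by blast
    qed
  qed (use V(1) in auto)
  finally show ?thesis by (simp add: mult_left_mono)
qed simp

lemma emeasure_density_indicator:
  assumes [measurable]: "A \<in> sets borel" "B \<in> sets borel"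
  shows "emeasure (density lborel (indicator A)) B = emeasure lborel (A \<inter> B)"
proof -
  have "emeasure (density lborel (indicator A)) B = (\<integral>\<^sup>+ x. indicator A x * indicator B x \<partial>lborel)"
    by (rule emeasure_density) auto
  also have "\<dots> = (\<integral>\<^sup>+ x. indicator (A \<inter> B) x \<partial>lborel)"
    by (simp only: indicator_inter_arith)
  also have "\<dots> = emeasure lborel (A \<inter> B)"
    by (rule nn_integral_indicator) auto
  finally show ?thesis .
qed

text \<open>
  The inverse map is a parameter of its own, so that the two directions are exchanged by swapping
  parameters.
\<close>

locale near_identity_homeomorphism =
  fixes \<phi> P :: "'a::euclidean_space \<Rightarrow> 'a" and \<Omega> :: "'a set" and \<eta> :: real
  assumes contP: "continuous_on UNIV P" and \<phi>P [simp]: "\<phi> (P x) = x" and P\<phi> [simp]: "P (\<phi> x) = x"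
    and open\<Omega>: "open \<Omega>" and near: "near_identity \<eta> \<phi> \<Omega>" and \<eta>: "\<eta> \<ge> 0"
begin

lemma image_eq_vimage: "\<phi> ` A = P -` A"
  by (auto intro: image_eqI[where x="P _"])

lemma borel_image: "A \<in> sets borel \<Longrightarrow> \<phi> ` A \<in> sets borel"
  using measurable_sets[OF borel_measurable_continuous_onI[OF contP]] by (simp add: image_eq_vimage)

lemma emeasure_image_open:
  assumes "open V" "V \<subseteq> \<Omega>"
  shows "emeasure lborel (\<phi> ` V) \<le> ennreal (distortion DIM('a) \<eta>) * emeasure lborel V"
proof -
  let ?V = "\<lambda>k::nat. V \<inter> ball 0 (real k)"
  have V: "V = (\<Union>k. ?V k)"
    using real_arch_simple by (auto simp: ) (meson reals_Archimedean2)
  have "emeasure lborel (\<phi> ` V) = emeasure lborel (\<Union>k. \<phi> ` ?V k)"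
    by (subst V) (simp only: image_UN)
  also have "\<dots> = (SUP k. emeasure lborel (\<phi> ` ?V k))"
  proof (rule SUP_emeasure_incseq[symmetric])
    show "range (\<lambda>k. \<phi> ` ?V k) \<subseteq> sets lborel"
      using assms(1) by (auto intro!: borel_image)
    show "incseq (\<lambda>k. \<phi> ` ?V k)"
      by (auto simp: incseq_def)
  qed
  also have "\<dots> \<le> ennreal (distortion DIM('a) \<eta>) * emeasure lborel V"
  proof (rule SUP_least)
    fix k
    have "emeasure lborel (\<phi> ` ?V k) \<le> ennreal (distortion DIM('a) \<eta>) * emeasure lborel (?V k)"
      using assms by (intro near_identity_emeasure_bounded[OF near \<eta>]) auto
    also have "\<dots> \<le> ennreal (distortion DIM('a) \<eta>) * emeasure lborel V"
      using assms(1) by (intro mult_left_mono emeasure_mono) auto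
    finally show "emeasure lborel (\<phi> ` ?V k) \<le> ennreal (distortion DIM('a) \<eta>) * emeasure lborel V" .
  qed
  finally show ?thesis .
qed

text \<open>
  Outer regularity extends the estimate from open sets to Borel sets.
\<close>

lemma emeasure_image_borel:
  assumes E: "E \<in> sets borel" "E \<subseteq> \<Omega>"
  shows "emeasure lborel (\<phi> ` E) \<le> ennreal (distortion DIM('a) \<eta>) * emeasure lborel E"
proof -
  have step: "emeasure lborel (\<phi> ` E) \<le> ennreal (distortion DIM('a) \<eta>) * (emeasure lborel E + ennreal e)" if e: "e > 0" for e
  proof -
    obtain V where V: "open V" "E \<subseteq> V" "emeasure lborel (V - E) < ennreal e"
      using outer_regular_lborel[OF E(1) e] by blast
    have "emeasure lborel (\<phi> ` E) \<le> emeasure lborel (\<phi> ` (V \<inter> \<Omega>))"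
      using V E borel_image open\<Omega> by (intro emeasure_mono) auto
    also have "\<dots> \<le> ennreal (distortion DIM('a) \<eta>) * emeasure lborel (V \<inter> \<Omega>)"
      using V(1) open\<Omega> by (intro emeasure_image_open) auto
    also have "emeasure lborel (V \<inter> \<Omega>) \<le> emeasure lborel (E \<union> (V - E))"
      using V(1) E by (intro emeasure_mono) auto
    also have "\<dots> \<le> emeasure lborel E + emeasure lborel (V - E)"
      using V(1) E by (intro emeasure_subadditive) auto
    also have "\<dots> \<le> emeasure lborel E + ennreal e"
      using V(3) by (intro add_left_mono) auto
    finally show ?thesis by (simp add: mult_left_mono)
  qed
  have "((\<lambda>e. ennreal (distortion DIM('a) \<eta>) * (emeasure lborel E + ennreal e)) \<longlongrightarrow> ennreal (distortion DIM('a) \<eta>) * (emeasure lborel E + ennreal 0)) (at_right 0)"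
    by (intro ennreal_tendsto_cmult tendsto_add tendsto_const tendsto_ennrealI tendsto_ident_at) simp
  from tendsto_lowerbound[OF this]
  show ?thesis using step by (simp add: eventually_at_filter)
qed

text \<open>
  One half of a change of variables, as an inequality: the image of Lebesgue measure on $\varphi(\Omega)$
  under the inverse map is dominated by a multiple of Lebesgue measure on \<open>\<Omega>\<close>.
\<close>

lemma nn_integral_image_le:
  assumes h: "h \<in> borel_measurable borel"
  shows "(\<integral>\<^sup>+ x. h (P x) * indicator (\<phi> ` \<Omega>) x \<partial>lborel) \<le> ennreal (distortion DIM('a) \<eta>) * (\<integral>\<^sup>+ x. h x * indicator \<Omega> x \<partial>lborel)"
proof -
  have [measurable]: "P \<in> borel_measurable borel" "\<Omega> \<in> sets borel" "\<phi> ` \<Omega> \<in> sets borel"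
    using contP open\<Omega> borel_image by (auto intro: borel_measurable_continuous_onI)
  note [measurable] = h
  define \<nu> where "\<nu> = distr (density lborel (indicator (\<phi> ` \<Omega>))) borel P"
  define \<mu> where "\<mu> = scale_measure (ennreal (distortion DIM('a) \<eta>)) (density lborel (indicator \<Omega>))"
  have "\<nu> \<le> \<mu>"
  proof (subst le_measure)
    show sets: "sets \<nu> = sets \<mu>" by (simp add: \<nu>_def \<mu>_def)
    show "\<forall>A\<in>sets \<nu>. emeasure \<nu> A \<le> emeasure \<mu> A"
    proof
      fix A assume "A \<in> sets \<nu>"
      then have A [measurable]: "A \<in> sets borel" by (simp add: \<nu>_def)
      have [measurable]: "P -` A \<in> sets borel"
        using borel_image[OF A] by (simp add: image_eq_vimage)
      have "emeasure \<nu> A = emeasure lborel (\<phi> ` \<Omega> \<inter> P -` A)"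
        unfolding \<nu>_def by (simp add: emeasure_distr emeasure_density_indicator)
      also have "\<phi> ` \<Omega> \<inter> P -` A = \<phi> ` (\<Omega> \<inter> A)"
        by (simp add: image_eq_vimage vimage_Int)
      finally have "emeasure \<nu> A = emeasure lborel (\<phi> ` (\<Omega> \<inter> A))" .
      also have "\<dots> \<le> ennreal (distortion DIM('a) \<eta>) * emeasure lborel (\<Omega> \<inter> A)"
        by (rule emeasure_image_borel) auto
      also have "emeasure lborel (\<Omega> \<inter> A) = emeasure (density lborel (indicator \<Omega>)) A"
        by (simp add: emeasure_density_indicator)
      finally show "emeasure \<nu> A \<le> emeasure \<mu> A" by (simp add: \<mu>_def)
    qed
  qed
  then have "nn_integral \<nu> h \<le> nn_integral \<mu> h"
    by (intro nn_integral_mono_measure) (simp_all add: \<nu>_def \<mu>_def)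
  moreover have "nn_integral \<nu> h = (\<integral>\<^sup>+ x. h (P x) * indicator (\<phi> ` \<Omega>) x \<partial>lborel)"
    by (simp add: \<nu>_def nn_integral_distr nn_integral_density mult.commute)
  moreover have "nn_integral \<mu> h = ennreal (distortion DIM('a) \<eta>) * (\<integral>\<^sup>+ x. h x * indicator \<Omega> x \<partial>lborel)"
    by (simp add: \<mu>_def nn_integral_scale_measure nn_integral_density mult.commute)
  ultimately show ?thesis by simp
qed

end

section \<open>Transplantation of test functions\<close>

lemma C1_compose:
  fixes P :: "real ^ 'n \<Rightarrow> real ^ 'n"
  assumes \<psi>: "C1 \<psi>" and P: "C1_map P"
  shows "C1 (\<lambda>y. \<psi> (P y))" "gradient (\<lambda>y. \<psi> (P y)) y = gradient \<psi> (P y) v* jacobian P (at y)"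
proof -
  have D: "(P has_derivative (\<lambda>h. jacobian P (at y) *v h)) (at y)" for y
    using P by (simp add: C1_map_def differentiable_on_def flip: jacobian_works)
  have d: "((\<lambda>y. \<psi> (P y)) has_derivative (\<lambda>h. (gradient \<psi> (P y) v* jacobian P (at y)) \<bullet> h)) (at y)" for y
    using has_derivative_compose[OF D C1_derivative[OF \<psi>]] by (simp add: dot_lmul_matrix)
  have cP: "continuous_on UNIV P"
    using P by (simp add: C1_map_def differentiable_imp_continuous_on)
  have cJ: "continuous_on UNIV (\<lambda>y. jacobian P (at y))"
    using P by (simp add: C1_map_def)
  show "C1 (\<lambda>y. \<psi> (P y))"
  proof (rule C1_I[OF d])
    show "continuous_on UNIV (\<lambda>y. gradient \<psi> (P y) v* jacobian P (at y))"
      unfolding vector_matrix_mult_def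
      by (intro continuous_on_vec_lambda continuous_on_sum continuous_on_mult continuous_on_component cJ
          continuous_on_compose2[OF C1_gradient_continuous[OF \<psi>] cP]) auto
  qed
  show "gradient (\<lambda>y. \<psi> (P y)) y = gradient \<psi> (P y) v* jacobian P (at y)"
    by (rule gradient_eqI[OF d])
qed

text \<open>
  The gradient of the composition is the transposed Jacobian applied to $\nabla\psi$, and the
  Jacobian of a map with Lipschitz constant $1+\eta$ has operator norm at most $1+\eta$.
\<close>

lemma norm_gradient_compose_le:
  fixes P :: "real ^ 'n \<Rightarrow> real ^ 'n"
  assumes \<psi>: "C1 \<psi>" and P: "C1_map P" "near_identity \<eta> P U" "open U" "y \<in> U"
  shows "norm (gradient (\<lambda>y. \<psi> (P y)) y) \<le> (1 + \<eta>) * norm (gradient \<psi> (P y))"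
proof -
  let ?v = "gradient (\<lambda>y. \<psi> (P y)) y" and ?J = "jacobian P (at y)"
  have D: "(P has_derivative (\<lambda>h. ?J *v h)) (at y)"
    using P(1) by (simp add: C1_map_def differentiable_on_def flip: jacobian_works)
  have J: "norm (?J *v h) \<le> (1 + \<eta>) * norm h" for h
    by (rule has_derivative_Lipschitz_bound[OF D P(3,4)]) (rule near_identity_Lipschitz[OF P(2) _ P(4)])
  have "(norm ?v)\<^sup>2 = gradient \<psi> (P y) \<bullet> (?J *v ?v)"
    unfolding power2_norm_eq_inner by (subst C1_compose(2)[OF \<psi> P(1)]) (simp only: dot_lmul_matrix)
  also have "\<dots> \<le> norm (gradient \<psi> (P y)) * norm (?J *v ?v)" by (rule norm_cauchy_schwarz)
  also have "\<dots> \<le> norm (gradient \<psi> (P y)) * ((1 + \<eta>) * norm ?v)"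
    by (intro mult_left_mono J) simp
  finally have "norm ?v * norm ?v \<le> ((1 + \<eta>) * norm (gradient \<psi> (P y))) * norm ?v"
    by (simp add: power2_eq_square mult_ac)
  then show ?thesis
  proof (cases "norm ?v = 0")
    case True
    have "0 \<le> (1 + \<eta>) * norm h" for h :: "real ^ 'n"
      using order_trans[OF norm_ge_zero J[of h]] .
    with True show ?thesis by simp
  next
    case False
    then have "norm ?v > 0" by simp
    with \<open>norm ?v * norm ?v \<le> _\<close> show ?thesis by (rule mult_right_le_imp_le)
  qed
qed

text \<open>
  The metric assumptions are symmetric in \<open>\<phi>\<close> and its inverse \<open>P\<close>. Functions on \<open>\<Omega>\<close> are transplanted
  by composition with \<open>P\<close>, which is therefore the map assumed to be $C^1$.
\<close>

locale near_identity_diffeomorphism =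
  fixes \<phi> P :: "real ^ 'n \<Rightarrow> real ^ 'n" and \<Omega> \<Sigma> :: "(real ^ 'n) set" and \<eta> :: real
  assumes cont\<phi>: "continuous_on UNIV \<phi>" and C1P: "C1_map P"
    and \<phi>P [simp]: "\<phi> (P x) = x" and P\<phi> [simp]: "P (\<phi> x) = x"
    and open\<Omega>: "open \<Omega>" and \<Sigma>: "\<Sigma> \<inter> \<Omega> = {}" "\<Sigma> \<noteq> {}" and \<eta>: "\<eta> \<ge> 0"
    and near: "near_identity \<eta> \<phi> (\<Omega> \<union> \<Sigma>)" and near_inv: "near_identity \<eta> P (\<phi> ` (\<Omega> \<union> \<Sigma>))"
begin

lemma contP: "continuous_on UNIV P"
  using C1P by (simp add: C1_map_def differentiable_imp_continuous_on)

lemma near_\<Omega>: "near_identity \<eta> \<phi> \<Omega>" "near_identity \<eta> P (\<phi> ` \<Omega>)"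
  using near near_inv by (auto simp: near_identity_def)

lemma image_inverse [simp]: "P ` \<phi> ` A = A"
  by (simp add: image_image)

lemma image_disjoint: "\<phi> ` \<Sigma> \<inter> \<phi> ` \<Omega> = {}"
proof -
  have "inj \<phi>" by (rule inj_on_inverseI[of _ P]) simp
  from image_Int[OF this, of \<Sigma> \<Omega>] show ?thesis by (simp add: \<Sigma>(1))
qed

lemma open_image: "open (\<phi> ` \<Omega>)"
proof -
  have "\<phi> ` \<Omega> = P -` \<Omega>" by (auto intro: image_eqI[where x="P _"])
  then show ?thesis using open\<Omega> contP by (simp add: continuous_on_open_vimage)
qed

sublocale fwd: near_identity_homeomorphism \<phi> P \<Omega> \<eta>
  using contP open\<Omega> near_\<Omega> \<eta> by unfold_locales auto

sublocale bwd: near_identity_homeomorphism P \<phi> "\<phi> ` \<Omega>" \<eta>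
  using cont\<phi> open_image near_\<Omega> \<eta> by unfold_locales auto

text \<open>
  Apply the Hardy inequality on the image to \<open>\<psi> \<circ> P\<close> and carry both integrals back to \<open>\<Omega>\<close>. Each of
  the two integrals costs one factor \<open>K\<close>: the square of a Lipschitz constant, from the distance or
  the gradient, times the volume distortion.
\<close>

lemma hardy_inequality_transplanted:
  assumes \<psi>: "\<psi> \<in> test_functions \<Omega>"
  defines "K \<equiv> (1 + \<eta>)\<^sup>2 * distortion CARD('n) \<eta>"
  shows "hardy_infimum (\<phi> ` \<Omega>) (\<phi> ` \<Sigma>) * (\<integral>\<^sup>+ x. ennreal ((\<psi> x)\<^sup>2 / (infdist x \<Sigma>)\<^sup>2) \<partial>lebesgue_on \<Omega>)
    \<le> ennreal (K\<^sup>2) * (\<integral>\<^sup>+ x. ennreal ((norm (gradient \<psi> x))\<^sup>2) \<partial>lebesgue_on \<Omega>)"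
proof -
  obtain S where S: "C1 \<psi>" "compact S" "S \<subseteq> \<Omega>" "\<And>x. x \<notin> S \<Longrightarrow> \<psi> x = 0"
    using test_functionsE[OF \<psi>] by metis
  let ?\<Omega> = "\<phi> ` \<Omega>" and ?\<Sigma> = "\<phi> ` \<Sigma>" and ?L = "ennreal (distortion CARD('n) \<eta>)"
  let ?l = "ennreal ((1 + \<eta>)\<^sup>2)"
  define w where "w y = \<psi> (P y)" for y
  have w: "C1 w" unfolding w_def by (rule C1_compose[OF S(1) C1P])
  have D0: "distortion CARD('n) \<eta> \<ge> 0" using \<eta> by (simp add: distortion_def)
  have lL: "?l * ?L = ennreal K"
    unfolding K_def using D0 by (simp add: ennreal_mult)
  have K0: "K \<ge> 0" unfolding K_def using D0 by simp
  have meas: "(\<lambda>x. ennreal ((v x)\<^sup>2 / (infdist x A)\<^sup>2)) \<in> borel_measurable borel" if "C1 v" for v :: "real ^ 'n \<Rightarrow> real" and A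
  proof -
    have [measurable]: "v \<in> borel_measurable borel" "(\<lambda>x. infdist x A) \<in> borel_measurable borel"
      by (intro borel_measurable_continuous_onI C1_continuous[OF that] continuous_intros)+
    show ?thesis by measurable
  qed
  have gmeas: "(\<lambda>x. ennreal ((norm (gradient v x))\<^sup>2)) \<in> borel_measurable borel" if "C1 v" for v :: "real ^ 'n \<Rightarrow> real"
  proof -
    have "(\<lambda>x. (norm (gradient v x))\<^sup>2) \<in> borel_measurable borel"
      by (intro borel_measurable_continuous_onI continuous_intros C1_gradient_continuous[OF that])
    then show ?thesis by measurable
  qed
  let ?q = "\<lambda>x. ennreal ((\<psi> x)\<^sup>2 / (infdist x \<Sigma>)\<^sup>2)" and ?r = "\<lambda>y. ennreal ((w y)\<^sup>2 / (infdist y ?\<Sigma>)\<^sup>2)"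
  let ?a = "\<lambda>x. ennreal ((norm (gradient \<psi> x))\<^sup>2)" and ?b = "\<lambda>y. ennreal ((norm (gradient w y))\<^sup>2)"
  have q: "?q x \<le> ?l * ?r (\<phi> x)" if x: "x \<in> \<Omega>" for x
  proof -
    have dx: "infdist x \<Sigma> > 0"
      by (rule infdist_pos_of_open[OF open\<Omega> \<Sigma> x])
    have dy: "infdist (\<phi> x) ?\<Sigma> > 0"
      by (rule infdist_pos_of_open[OF open_image image_disjoint]) (use \<Sigma> x in auto)
    have "infdist (\<phi> x) ?\<Sigma> \<le> (1 + \<eta>) * infdist x \<Sigma>"
      using x \<Sigma>(2) by (intro infdist_image_le[OF near \<eta>]) auto
    then have "(infdist (\<phi> x) ?\<Sigma>)\<^sup>2 \<le> (1 + \<eta>)\<^sup>2 * (infdist x \<Sigma>)\<^sup>2"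
      using dy by (subst power_mult_distrib[symmetric]) (intro power_mono, auto)
    then have "(\<psi> x)\<^sup>2 * (infdist (\<phi> x) ?\<Sigma>)\<^sup>2 \<le> (\<psi> x)\<^sup>2 * ((1 + \<eta>)\<^sup>2 * (infdist x \<Sigma>)\<^sup>2)"
      by (intro mult_left_mono) auto
    then have "(\<psi> x)\<^sup>2 / (infdist x \<Sigma>)\<^sup>2 \<le> (1 + \<eta>)\<^sup>2 * ((w (\<phi> x))\<^sup>2 / (infdist (\<phi> x) ?\<Sigma>)\<^sup>2)"
      using dx dy by (simp add: w_def field_simps)
    then show ?thesis by (simp add: ennreal_mult[symmetric] ennreal_leI)
  qed
  have g: "?b y \<le> ?l * ?a (P y)" if y: "y \<in> ?\<Omega>" for y
  proof -
    have "norm (gradient w y) \<le> (1 + \<eta>) * norm (gradient \<psi> (P y))"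
      unfolding w_def by (rule norm_gradient_compose_le[OF S(1) C1P near_\<Omega>(2) open_image y])
    then have "(norm (gradient w y))\<^sup>2 \<le> ((1 + \<eta>) * norm (gradient \<psi> (P y)))\<^sup>2"
      by (intro power_mono) auto
    then show ?thesis by (simp add: ennreal_mult[symmetric] ennreal_leI power_mult_distrib)
  qed
  have "(\<integral>\<^sup>+ x. ?q x \<partial>lebesgue_on \<Omega>) = (\<integral>\<^sup>+ x. ?q x * indicator \<Omega> x \<partial>lborel)"
    by (rule nn_integral_lebesgue_on_eq[OF open\<Omega> meas[OF S(1)]])
  also have "\<dots> \<le> (\<integral>\<^sup>+ x. ?l * (?r (\<phi> x) * indicator \<Omega> x) \<partial>lborel)"
    using q by (intro nn_integral_mono) (auto simp: indicator_def)
  also have "\<dots> = ?l * (\<integral>\<^sup>+ x. ?r (\<phi> x) * indicator \<Omega> x \<partial>lborel)"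
    using measurable_compose[OF borel_measurable_continuous_onI[OF cont\<phi>] meas[OF w, of ?\<Sigma>]] open\<Omega>
    by (intro nn_integral_cmult borel_measurable_times_ennreal borel_measurable_indicator) simp_all
  also have "\<dots> \<le> ?l * (?L * (\<integral>\<^sup>+ y. ?r y * indicator ?\<Omega> y \<partial>lborel))"
    using bwd.nn_integral_image_le[OF meas[OF w, of ?\<Sigma>]] by (intro mult_left_mono) simp_all
  also have "\<dots> = ennreal K * (\<integral>\<^sup>+ y. ?r y \<partial>lebesgue_on ?\<Omega>)"
    by (simp only: nn_integral_lebesgue_on_eq[OF open_image meas[OF w]] lL mult.assoc[symmetric])
  finally have lower: "(\<integral>\<^sup>+ x. ?q x \<partial>lebesgue_on \<Omega>) \<le> ennreal K * (\<integral>\<^sup>+ y. ?r y \<partial>lebesgue_on ?\<Omega>)" .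
  have "(\<integral>\<^sup>+ y. ?b y \<partial>lebesgue_on ?\<Omega>) = (\<integral>\<^sup>+ y. ?b y * indicator ?\<Omega> y \<partial>lborel)"
    by (rule nn_integral_lebesgue_on_eq[OF open_image gmeas[OF w]])
  also have "\<dots> \<le> (\<integral>\<^sup>+ y. ?l * (?a (P y) * indicator ?\<Omega> y) \<partial>lborel)"
    using g by (intro nn_integral_mono) (auto simp: indicator_def)
  also have "\<dots> = ?l * (\<integral>\<^sup>+ y. ?a (P y) * indicator ?\<Omega> y \<partial>lborel)"
    using measurable_compose[OF borel_measurable_continuous_onI[OF contP] gmeas[OF S(1)]] open_image
    by (intro nn_integral_cmult borel_measurable_times_ennreal borel_measurable_indicator) simp_all
  also have "\<dots> \<le> ?l * (?L * (\<integral>\<^sup>+ x. ?a x * indicator \<Omega> x \<partial>lborel))"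
    using fwd.nn_integral_image_le[OF gmeas[OF S(1)]] by (intro mult_left_mono) simp_all
  also have "\<dots> = ennreal K * (\<integral>\<^sup>+ x. ?a x \<partial>lebesgue_on \<Omega>)"
    by (simp only: nn_integral_lebesgue_on_eq[OF open\<Omega> gmeas[OF S(1)]] lL mult.assoc[symmetric])
  finally have upper: "(\<integral>\<^sup>+ y. ?b y \<partial>lebesgue_on ?\<Omega>) \<le> ennreal K * (\<integral>\<^sup>+ x. ?a x \<partial>lebesgue_on \<Omega>)" .
  have hardy: "hardy_infimum ?\<Omega> ?\<Sigma> * (\<integral>\<^sup>+ y. ?r y \<partial>lebesgue_on ?\<Omega>) \<le> (\<integral>\<^sup>+ y. ?b y \<partial>lebesgue_on ?\<Omega>)"
  proof (rule hardy_inequality_C1[OF open_image w])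
    show "compact (\<phi> ` S)"
      using S(2) by (intro compact_continuous_image continuous_on_subset[OF cont\<phi>]) auto
    show "\<phi> ` S \<subseteq> ?\<Omega>" using S(3) by blast
    show "w y = 0" if "y \<notin> \<phi> ` S" for y
      unfolding w_def
    proof (rule S(4), rule notI)
      assume "P y \<in> S"
      then have "\<phi> (P y) \<in> \<phi> ` S" by blast
      with that show False by simp
    qed
  qed
  have "hardy_infimum ?\<Omega> ?\<Sigma> * (\<integral>\<^sup>+ x. ?q x \<partial>lebesgue_on \<Omega>)
      \<le> ennreal K * (hardy_infimum ?\<Omega> ?\<Sigma> * (\<integral>\<^sup>+ y. ?r y \<partial>lebesgue_on ?\<Omega>))"
    using mult_left_mono[OF lower, of "hardy_infimum ?\<Omega> ?\<Sigma>"] by (simp add: mult.left_commute)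
  also have "\<dots> \<le> ennreal K * (ennreal K * (\<integral>\<^sup>+ x. ?a x \<partial>lebesgue_on \<Omega>))"
    by (intro mult_left_mono order_trans[OF hardy upper]) simp
  also have "\<dots> = ennreal (K\<^sup>2) * (\<integral>\<^sup>+ x. ?a x \<partial>lebesgue_on \<Omega>)"
    using K0 by (simp only: power2_eq_square ennreal_mult mult.assoc)
  finally show ?thesis .
qed

lemma hardy_infimum_image_le:
  "hardy_infimum (\<phi> ` \<Omega>) (\<phi> ` \<Sigma>)
    \<le> ennreal (((1 + \<eta>)\<^sup>2 * distortion CARD('n) \<eta>)\<^sup>2) * hardy_infimum \<Omega> \<Sigma>"
proof -
  define F where "F = ((1 + \<eta>)\<^sup>2 * distortion CARD('n) \<eta>)\<^sup>2"
  let ?H = "hardy_infimum (\<phi> ` \<Omega>) (\<phi> ` \<Sigma>)"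
  have "1 + \<eta> > 0" "1 + real CARD('n) * \<eta> > 0" using \<eta> by (auto intro: add_pos_nonneg)
  then have F: "F > 0" unfolding F_def distortion_def by (intro zero_less_power mult_pos_pos)
  then have inv: "ennreal (1 / F) * ennreal F = 1" by (simp add: ennreal_mult[symmetric])
  have "ennreal (1 / F) * ?H \<le> hardy_infimum \<Omega> \<Sigma>"
    unfolding hardy_infimum_def[of \<Omega> \<Sigma>]
  proof (rule Inf_greatest, clarify)
    fix u g assume u: "H10_gradient \<Omega> u g" "\<not> (AE x in lebesgue_on \<Omega>. u x = 0)"
    show "ennreal (1 / F) * ?H \<le> hardy_quotient \<Omega> \<Sigma> u g"
    proof (rule hardy_quotient_test_functions_bound[OF open\<Omega> \<Sigma> _ u])
      fix \<psi> assume "\<psi> \<in> test_functions \<Omega>"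
      from mult_left_mono[OF hardy_inequality_transplanted[OF this] zero_le, of "ennreal (1 / F)"]
      show "ennreal (1 / F) * ?H * (\<integral>\<^sup>+ x. ennreal ((\<psi> x)\<^sup>2 / (infdist x \<Sigma>)\<^sup>2) \<partial>lebesgue_on \<Omega>)
        \<le> (\<integral>\<^sup>+ x. ennreal ((norm (gradient \<psi> x))\<^sup>2) \<partial>lebesgue_on \<Omega>)"
        unfolding F_def[symmetric] by (simp only: mult.assoc[symmetric] inv mult_1)
    qed
  qed
  from mult_left_mono[OF this, of "ennreal F"] inv show ?thesis
    unfolding F_def[symmetric] by (simp add: mult.assoc[symmetric] mult.commute[of "ennreal F"])
qed

end

section \<open>Stability of the Hardy constant\<close>

lemma power_one_plus_le:
  fixes t :: real
  assumes "0 \<le> t" "t \<le> 1"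
  shows "(1 + t) ^ m \<le> 1 + (2 ^ m - 1) * t"
proof (induction m)
  case (Suc m)
  have "(1 + t) ^ Suc m \<le> (1 + t) * (1 + (2 ^ m - 1) * t)"
    using Suc assms by simp
  also have "\<dots> = 1 + t + (2 ^ m - 1) * t + ((2 ^ m - 1) * t) * t"
    by (simp add: algebra_simps)
  also have "((2 ^ m - 1) * t) * t \<le> ((2 ^ m - 1) * t) * 1"
    using assms by (intro mult_left_mono) auto
  finally show ?case by (simp add: algebra_simps)
qed simp

text \<open>
  If one of the two numbers is infinite then so is the other, and both are converted to 0. Otherwise
  the two multiplicative bounds give errors $(F-1)H$ and $(F-1)H'$, where $H'\le MH$.
\<close>

lemma enn2real_abs_diff_le:
  assumes "H' \<le> ennreal F * H" "H \<le> ennreal F * H'" "F \<ge> 1" "F \<le> 1 + M * t" "F \<le> M" "t \<ge> 0"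
  shows "\<bar>enn2real H' - enn2real H\<bar> \<le> M\<^sup>2 * t * enn2real H"
proof (cases "H = top")
  case True
  then have "H' = top" using assms(2) by (cases "H' = top") (auto simp: top_unique ennreal_mult_eq_top_iff)
  then show ?thesis using True by simp
next
  case False
  then have top: "ennreal F * H \<noteq> top" by (simp add: ennreal_mult_eq_top_iff)
  then have top': "H' \<noteq> top" using assms(1) by (auto simp: top_unique)
  then have top2: "ennreal F * H' \<noteq> top" by (simp add: ennreal_mult_eq_top_iff)
  let ?h = "enn2real H" and ?h' = "enn2real H'"
  have "?h' \<le> enn2real (ennreal F * H)"
    using assms(1) top by (intro enn2real_mono) (auto simp: less_top)
  then have 1: "?h' \<le> F * ?h" using assms(3) by (simp add: enn2real_mult)
  have "?h \<le> enn2real (ennreal F * H')"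
    using assms(2) top2 by (intro enn2real_mono) (auto simp: less_top)
  then have 2: "?h \<le> F * ?h'" using assms(3) by (simp add: enn2real_mult)
  have h: "?h \<ge> 0" "?h' \<ge> 0" by auto
  have M: "M \<ge> 1" using assms by simp
  have "?h' - ?h \<le> (F - 1) * ?h" using 1 by (simp add: algebra_simps)
  also have "\<dots> \<le> (M * t) * ?h" using assms(4) h by (intro mult_right_mono) auto
  also have "\<dots> \<le> (M * t) * (M * ?h)"
    using M h assms(6) mult_right_mono[OF M h(1)] by (intro mult_left_mono) auto
  finally have A: "?h' - ?h \<le> M\<^sup>2 * t * ?h" by (simp add: power2_eq_square mult_ac)
  have "?h - ?h' \<le> (F - 1) * ?h'" using 2 by (simp add: algebra_simps)
  also have "\<dots> \<le> (M * t) * ?h'" using assms(4) h by (intro mult_right_mono) auto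
  also have "?h' \<le> M * ?h" using 1 mult_right_mono[OF assms(5) h(1)] by simp
  finally have "?h - ?h' \<le> (M * t) * (M * ?h)" using M assms(6) by (simp add: mult_left_mono)
  then have "?h - ?h' \<le> M\<^sup>2 * t * ?h" by (simp add: power2_eq_square mult_ac)
  with A show ?thesis by simp
qed

theorem theorem3p1:
  fixes \<Omega> \<Sigma> :: "(real ^ 'n) set"
  assumes "open \<Omega>" and "\<Omega> \<noteq> {}" and "frontier \<Omega> \<noteq> {}"
    and "\<Sigma> \<subseteq> frontier \<Omega>" and "\<Sigma> \<noteq> {}"
  shows "\<exists>\<epsilon>>0. \<exists>c>0. \<forall>\<phi> :: real ^ 'n \<Rightarrow> real ^ 'n.
    C1_diffeomorphism \<phi> \<and> jacobian_deviation \<phi> UNIV < ennreal \<epsilon> \<longrightarrow>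
      \<bar>hardy_constant (\<phi> ` \<Omega>) (\<phi> ` \<Sigma>) - hardy_constant \<Omega> \<Sigma>\<bar>
        \<le> c * hardy_constant \<Omega> \<Sigma> * enn2real (jacobian_deviation \<phi> (co_map \<phi> \<Omega>))"
proof -
  define n where "n = real CARD('n)"
  define M :: real where "M = 2 ^ (2 * CARD('n) + 4)"
  have n: "n \<ge> 1" by (simp add: n_def Suc_le_eq)
  have M: "M > 0" by (simp add: M_def)
  have "\<bar>hardy_constant (\<phi> ` \<Omega>) (\<phi> ` \<Sigma>) - hardy_constant \<Omega> \<Sigma>\<bar>
        \<le> (M\<^sup>2 * (2 * n)) * hardy_constant \<Omega> \<Sigma> * enn2real (jacobian_deviation \<phi> (co_map \<phi> \<Omega>))"
    if \<phi>: "C1_diffeomorphism \<phi>" and small: "jacobian_deviation \<phi> UNIV < ennreal (1 / (2 * n))"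
    for \<phi> :: "real ^ 'n \<Rightarrow> real ^ 'n"
  proof -
    let ?J = "jacobian_deviation \<phi> (co_map \<phi> \<Omega>)"
    define \<delta> where "\<delta> = enn2real ?J"
    define P where "P = inv \<phi>"
    have "?J \<le> jacobian_deviation \<phi> UNIV"
      unfolding jacobian_deviation_def by (intro SUP_subset_mono) auto
    then have J: "?J < ennreal (1 / (2 * n))" using small by simp
    then have J': "?J = ennreal \<delta>" unfolding \<delta>_def by (intro ennreal_enn2real[symmetric]) (auto intro: less_trans)
    have \<delta>0: "\<delta> \<ge> 0" by (simp add: \<delta>_def)
    have \<delta>n: "\<delta> < 1 / (2 * n)" using J \<delta>0 unfolding J' by (simp add: ennreal_less_iff)
    then have \<delta>t: "2 * n * \<delta> \<le> 1" using n by (simp add: field_simps)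
    have "1 / (2 * n) \<le> 1 / 2" using n by (simp add: field_simps)
    then have \<delta>h: "\<delta> \<le> 1 / 2" using \<delta>n by simp
    have C1\<phi>: "C1_map \<phi>" and C1P: "C1_map P" and bij: "bij \<phi>"
      using \<phi> by (auto simp: C1_diffeomorphism_def P_def)
    have \<phi>P: "\<phi> (P x) = x" and P\<phi>: "P (\<phi> x) = x" for x
      using bij by (simp_all add: P_def bij_is_inj bij_is_surj surj_f_inv_f)
    have cont\<phi>: "continuous_on UNIV \<phi>" and contP: "continuous_on UNIV P"
      using C1\<phi> C1P by (simp_all add: C1_map_def differentiable_imp_continuous_on)
    have "onorm ((*v) (jacobian \<phi> (at x) - mat 1)) \<le> \<delta>" if "x \<in> convex hull \<Omega>" for x
    proof -
      have "ennreal (onorm ((*v) (jacobian \<phi> (at x) - mat 1))) \<le> ?J"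
        unfolding jacobian_deviation_def by (rule SUP_upper) (use that in \<open>simp add: co_map_def\<close>)
      then show ?thesis unfolding J' using \<delta>0 by simp
    qed
    then have "near_identity \<delta> \<phi> (convex hull \<Omega>)"
      by (intro near_identity_of_jacobian[OF C1\<phi>]) auto
    then have "near_identity \<delta> \<phi> \<Omega>"
      using hull_subset[of \<Omega> convex] unfolding near_identity_def by blast
    then have cl: "near_identity \<delta> \<phi> (closure \<Omega>)"
      by (rule near_identity_closure[OF _ cont\<phi>])
    have sub: "\<Omega> \<union> \<Sigma> \<subseteq> closure \<Omega>"
      using assms(4) closure_subset[of \<Omega>] by (auto simp: frontier_def)
    have near: "near_identity \<delta> \<phi> (\<Omega> \<union> \<Sigma>)"
      using cl sub unfolding near_identity_def by blast
    \<comment> \<open>The weaker constant makes the hypotheses on the map and its inverse identical.\<close>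
    have near2: "near_identity (2 * \<delta>) \<phi> (\<Omega> \<union> \<Sigma>)"
      unfolding near_identity_def
    proof (intro ballI)
      fix x y assume "x \<in> \<Omega> \<union> \<Sigma>" "y \<in> \<Omega> \<union> \<Sigma>"
      then have "norm (\<phi> x - \<phi> y - (x - y)) \<le> \<delta> * norm (x - y)"
        using near unfolding near_identity_def by blast
      also have "\<dots> \<le> 2 * \<delta> * norm (x - y)" using \<delta>0 by (intro mult_right_mono) auto
      finally show "norm (\<phi> x - \<phi> y - (x - y)) \<le> 2 * \<delta> * norm (x - y)" .
    qed
    have near_inv: "near_identity (2 * \<delta>) P (\<phi> ` (\<Omega> \<union> \<Sigma>))"
      by (rule near_identity_inverse[OF near P\<phi> \<delta>h])
    have disj: "\<Sigma> \<inter> \<Omega> = {}"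
      using assms(1,4) by (auto simp: frontier_def interior_open)
    interpret fwd: near_identity_diffeomorphism \<phi> P \<Omega> \<Sigma> "2 * \<delta>"
      using cont\<phi> C1P \<phi>P P\<phi> assms(1,5) disj \<delta>0 near2 near_inv by unfold_locales auto
    have img: "P ` \<phi> ` A = A" for A by (simp add: image_image P\<phi>)
    interpret bwd: near_identity_diffeomorphism P \<phi> "\<phi> ` \<Omega>" "\<phi> ` \<Sigma>" "2 * \<delta>"
    proof unfold_locales
      show "open (\<phi> ` \<Omega>)" by (rule fwd.open_image)
      show "\<phi> ` \<Sigma> \<inter> \<phi> ` \<Omega> = {}" by (rule fwd.image_disjoint)
      show "near_identity (2 * \<delta>) P (\<phi> ` \<Omega> \<union> \<phi> ` \<Sigma>)" using near_inv by (simp add: image_Un)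
      show "near_identity (2 * \<delta>) \<phi> (P ` (\<phi> ` \<Omega> \<union> \<phi> ` \<Sigma>))" using near2 by (simp add: image_Un img)
    qed (use contP C1\<phi> \<phi>P P\<phi> assms(5) \<delta>0 in auto)
    \<comment> \<open>The product of all distortion factors is estimated by a power of the single quantity $1+t$.\<close>
    define t where "t = 2 * n * \<delta>"
    define F where "F = ((1 + 2 * \<delta>)\<^sup>2 * distortion CARD('n) (2 * \<delta>))\<^sup>2"
    have t: "0 \<le> t" "t \<le> 1" "2 * \<delta> \<le> t"
      using \<delta>0 \<delta>t n mult_right_mono[OF n, of "2 * \<delta>"] by (simp_all add: t_def mult_ac)
    have dist: "distortion CARD('n) (2 * \<delta>) = (1 + t) ^ CARD('n)"
      by (simp add: distortion_def t_def n_def mult_ac)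
    have F1: "F \<ge> 1"
      unfolding F_def dist using t(1) \<delta>0 by (intro one_le_power mult_ge1_I) auto
    have "F \<le> ((1 + t)\<^sup>2 * (1 + t) ^ CARD('n))\<^sup>2"
      unfolding F_def dist using t \<delta>0 by (intro power_mono mult_right_mono) auto
    also have "\<dots> = (1 + t) ^ (2 * CARD('n) + 4)"
      by (simp add: power_add power_mult_distrib power_mult[symmetric] mult_ac)
    finally have F_le: "F \<le> (1 + t) ^ (2 * CARD('n) + 4)" .
    have "F \<le> 1 + (M - 1) * t"
      using F_le power_one_plus_le[OF t(1,2), of "2 * CARD('n) + 4"] unfolding M_def by linarith
    then have F_M: "F \<le> 1 + M * t" using t(1) by (simp add: algebra_simps)
    have "(1 + t) ^ (2 * CARD('n) + 4) \<le> M"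
      unfolding M_def using t by (intro power_mono) auto
    then have F_M2: "F \<le> M" using F_le by simp
    have "\<bar>enn2real (hardy_infimum (\<phi> ` \<Omega>) (\<phi> ` \<Sigma>)) - enn2real (hardy_infimum \<Omega> \<Sigma>)\<bar>
        \<le> M\<^sup>2 * t * enn2real (hardy_infimum \<Omega> \<Sigma>)"
      using fwd.hardy_infimum_image_le bwd.hardy_infimum_image_le
      by (intro enn2real_abs_diff_le[OF _ _ F1 F_M F_M2 t(1)]) (simp_all add: F_def img)
    then show ?thesis
      by (simp add: hardy_infimum_def hardy_constant_def t_def \<delta>_def mult_ac)
  qed
  note main = this
  have pos: "1 / (2 * n) > 0" "M\<^sup>2 * (2 * n) > 0" using n M by simp_all
  show ?thesis
    by (rule exI[of _ "1 / (2 * n)"], rule conjI[OF pos(1)], rule exI[of _ "M\<^sup>2 * (2 * n)"],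
        rule conjI[OF pos(2)], intro allI impI, elim conjE, rule main)
qed

end
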